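(* Let $t\in\mathbb{R}_{>0}$ and let $\eta_t$ be the random configuration of the TASEP at time $t$ started from the step configuration. The distribution of $\eta_t$ is invariant under the continuous-time Markov process with generator $A=tA^T+A^L$, that is, $$\mathbb{E}\left[(Af)(\eta_t)\right]=0$$ for all cylinder functions $f$.
   Context: Configurations are written via occupation variables $\eta:\mathbb{Z}\to\{0,1\}$, $\eta(x)=1$ iff there is a particle at $x$. $\mathcal{C}$ is the set of configurations which have a rightmost particle and are densely packed far to the left, $x_N=-N$ for all large $N$, where $x_1>x_2>\dots$ are the particle locations. The step configuration is $\eta(x)=\mathbf{1}_{x<0}$. A cylinder function depends on finitely many coordinates of $\eta$. For $x\ne y$, $\eta^{x,y}$ denotes the configuration obtained from $\eta$ by moving a particle from $x$ to $y$: $\eta^{x,y}(x)=\eta(x)-1$, $\eta^{x,y}(y)=\eta(y)+1$, $\eta^{x,y}(z)=\eta(z)$ for $z\ne x,y$. $A^T$ is the generator of the TASEP (each particle jumps right by one at rate $1$ if the destination is empty): $$(A^Tf)(\eta)=\sum_{x\in\mathbb{Z}}\eta(x)(1-\eta(x+1))\bigl(f(\eta^{x,x+1})-f(\eta)\bigr).$$ $A^L$ is the generator of the backwards Hammersley-type process: $$(A^Lf)(\eta)=\sum_{x\in\mathbb{Z}}\eta(x)\Bigl(\sum_{y=x}^\infty\eta(y)\Bigr)\sum_{m=1}^\infty\Bigl(\prod_{k=1}^m(1-\eta(x-k))\Bigr)\bigl(f(\eta^{x,x-m})-f(\eta)\bigr).$$ *)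

theory Defs
  imports "HOL-Probability.Probability"
begin

section \<open>Configurations\<close>

type_synonym config = "int \<Rightarrow> bool"

abbreviation occ :: "config \<Rightarrow> int \<Rightarrow> real" where
  "occ \<eta> x \<equiv> of_bool (\<eta> x)"

text \<open>The witness enumerates the particles from right to left; its values at indices \<open>N \<ge> 1\<close>
  are the locations \<open>x\<^sub>1 > x\<^sub>2 > \<dots>\<close> (index 0 is unused).\<close>

definition configs :: "config set" where
  "configs = {\<eta>. \<exists>x :: nat \<Rightarrow> int. (\<forall>i j. 1 \<le> i \<and> i < j \<longrightarrow> x j < x i)
                   \<and> {z. \<eta> z} = x ` {1..}
                   \<and> (\<forall>\<^sub>F N in sequentially. x N = - int N)}"

definition step :: config where
  "step = (\<lambda>x. x < 0)"

lemma step_in_configs: "step \<in> configs"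
proof -
  have "{z. step z} = (\<lambda>N. - int N) ` {1..}"
  proof (intro equalityI subsetI)
    fix z assume "z \<in> {z. step z}"
    then have "z = - int (nat (- z))" and "1 \<le> nat (- z)"
      by (auto simp: step_def)
    then show "z \<in> (\<lambda>N. - int N) ` {1..}" by blast
  qed (auto simp: step_def)
  then show ?thesis
    unfolding configs_def by (intro CollectI exI[of _ "\<lambda>N. - int N"]) auto
qed

definition cylinder :: "(config \<Rightarrow> real) \<Rightarrow> bool" where
  "cylinder f \<longleftrightarrow> (\<exists>S. finite S \<and> (\<forall>\<eta> \<zeta>. (\<forall>x\<in>S. \<eta> x = \<zeta> x) \<longrightarrow> f \<eta> = f \<zeta>))"

text \<open>\<open>\<eta>\<^sup>x\<^sup>,\<^sup>y\<close>. This is only meaningful when \<open>x\<close> is occupied and \<open>y\<close> is empty; in the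
  generators below all other cases carry a vanishing prefactor.\<close>

definition move :: "config \<Rightarrow> int \<Rightarrow> int \<Rightarrow> config" where
  "move \<eta> x y = \<eta>(x := False, y := True)"

section \<open>The generators\<close>

text \<open>For \<open>\<eta> \<in> configs\<close> only finitely many terms of each sum below are nonzero.\<close>

definition tasep_gen :: "(config \<Rightarrow> real) \<Rightarrow> config \<Rightarrow> real" where
  "tasep_gen f \<eta> =
     (\<Sum>\<^sub>\<infinity>x\<in>UNIV. occ \<eta> x * (1 - occ \<eta> (x + 1)) * (f (move \<eta> x (x + 1)) - f \<eta>))"

definition hammersley_gen :: "(config \<Rightarrow> real) \<Rightarrow> config \<Rightarrow> real" where
  "hammersley_gen f \<eta> =
     (\<Sum>\<^sub>\<infinity>x\<in>UNIV. occ \<eta> x * (\<Sum>\<^sub>\<infinity>y\<in>{x..}. occ \<eta> y) *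
        (\<Sum>\<^sub>\<infinity>m\<in>{1::nat..}. (\<Prod>k=1..m. 1 - occ \<eta> (x - int k)) *
           (f (move \<eta> x (x - int m)) - f \<eta>)))"

definition full_gen :: "real \<Rightarrow> (config \<Rightarrow> real) \<Rightarrow> config \<Rightarrow> real" where
  "full_gen t f \<eta> = t * tasep_gen f \<eta> + hammersley_gen f \<eta>"

section \<open>Continuous-time Markov processes with discrete distributions\<close>

definition markov_semigroup :: "'s set \<Rightarrow> (real \<Rightarrow> 's \<Rightarrow> 's pmf) \<Rightarrow> bool" where
  "markov_semigroup S P \<longleftrightarrow>
     (\<forall>\<eta>\<in>S. P 0 \<eta> = return_pmf \<eta>
        \<and> (\<forall>t\<ge>0. set_pmf (P t \<eta>) \<subseteq> S)
        \<and> (\<forall>s\<ge>0. \<forall>t\<ge>0. P (s + t) \<eta> = bind_pmf (P s \<eta>) (P t)))"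

text \<open>The elementary Markov property: the past is observed at the finitely many times in \<open>J\<close>,
  of which \<open>s\<close> is the last.\<close>

definition markov_process ::
  "'w measure \<Rightarrow> 's set \<Rightarrow> (real \<Rightarrow> 's \<Rightarrow> 's pmf) \<Rightarrow> (real \<Rightarrow> 'w \<Rightarrow> 's) \<Rightarrow> bool" where
  "markov_process M S P X \<longleftrightarrow>
     prob_space M \<and> (\<forall>t\<ge>0. X t \<in> M \<rightarrow>\<^sub>M count_space S) \<and>
     (\<forall>J s h z y. finite J \<and> J \<subseteq> {0..s} \<and> s \<in> J \<and> 0 \<le> h \<longrightarrow>
        measure M {\<omega> \<in> space M. (\<forall>u\<in>J. X u \<omega> = z u) \<and> X (s + h) \<omega> = y} =
        measure M {\<omega> \<in> space M. \<forall>u\<in>J. X u \<omega> = z u} * pmf (P h (z s)) y)"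

section \<open>The TASEP\<close>

text \<open>The semigroup has generator \<open>tasep_gen\<close> in the usual sense: the difference quotients
  at time 0 converge in supremum norm for every cylinder function.\<close>

definition tasep_semigroup :: "(real \<Rightarrow> config \<Rightarrow> config pmf) \<Rightarrow> bool" where
  "tasep_semigroup P \<longleftrightarrow> markov_semigroup configs P \<and>
     (\<forall>f. cylinder f \<longrightarrow>
        uniform_limit configs (\<lambda>h \<eta>. (measure_pmf.expectation (P h \<eta>) f - f \<eta>) / h)
          (tasep_gen f) (at_right 0))"

definition tasep_from_step :: "'w measure \<Rightarrow> (real \<Rightarrow> 'w \<Rightarrow> config) \<Rightarrow> bool" where
  "tasep_from_step M X \<longleftrightarrow>
     (\<exists>P. tasep_semigroup P \<and> markov_process M configs P X) \<and> (AE \<omega> in M. X 0 \<omega> = step)"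

end

theory Submission
  imports Defs
begin

text \<open>The two generators satisfy \<open>[A\<^sup>L, A\<^sup>T] = A\<^sup>T\<close> pointwise on \<open>configs\<close>. Write \<open>\<mu>\<^sub>t\<close> for the TASEP
  expectation at time \<open>t\<close> from the step configuration. By the forward equation
  \<open>\<mu>\<^sub>t(g)' = \<mu>\<^sub>t(A\<^sup>T g)\<close>, the functional \<open>\<nu>\<^sub>t(g) = \<mu>\<^sub>t(A\<^sup>L g) + t \<mu>\<^sub>t(A\<^sup>T g)\<close> has derivative
  \<open>\<mu>\<^sub>t(A\<^sup>T A\<^sup>L g + A\<^sup>T g + t A\<^sup>T A\<^sup>T g) = \<nu>\<^sub>t(A\<^sup>T g)\<close>, so it solves the forward equation itself, with
  \<open>\<nu>\<^sub>0 = 0\<close> because no particle of the step configuration can jump to the left. Hence \<open>\<nu>\<^sub>t = 0\<close>.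

  Unbounded rates are controlled by the area, the number of pairs of a hole and a particle to the
  right of it: every TASEP jump raises the area by one, the number of possible jumps is at most
  \<open>1 + area\<close>, and the total rate of \<open>A\<^sup>L\<close> is the area. So \<open>E (1 + area)\<^sup>3\<close> grows at most exponentially
  in time, which extends the forward equation from cylinder functions to functions of quadratic
  growth in the area. Uniqueness holds since \<open>A\<^sup>T\<close> preserves the functions vanishing on
  \<open>{area > n}\<close> and is bounded there.\<close>

section \<open>Commutation in particle coordinates\<close>

text \<open>Particle positions from right to left, with index shifted: \<open>X j\<close> is \<open>x\<^bsub>j+1\<^esub>\<close>.\<close>

definition particle_seqs :: "(nat \<Rightarrow> int) set" where
  "particle_seqs = {X. (\<forall>i j. i < j \<longrightarrow> X j < X i) \<and> (\<exists>n. \<forall>j\<ge>n. X j = - int j - 1)}"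

definition config_of :: "(nat \<Rightarrow> int) \<Rightarrow> config" where
  "config_of X = (\<lambda>x. x \<in> range X)"

definition right_op :: "nat \<Rightarrow> ((nat \<Rightarrow> int) \<Rightarrow> real) \<Rightarrow> (nat \<Rightarrow> int) \<Rightarrow> real" where
  "right_op j G X = (if j = 0 \<or> X j + 1 < X (j - 1) then G (X(j := X j + 1)) - G X else 0)"

text \<open>The rate \<open>j + 1\<close> is left out here and reinstated in
  \<open>commutator_sum\<close>, so that the single commutators have unit coefficients.\<close>

definition left_op :: "nat \<Rightarrow> ((nat \<Rightarrow> int) \<Rightarrow> real) \<Rightarrow> (nat \<Rightarrow> int) \<Rightarrow> real" where
  "left_op j G X = (\<Sum>z\<in>{X (Suc j)<..<X j}. G (X(j := z)) - G X)"

text \<open>Writing \<open>L\<^sub>j\<close>, \<open>R\<^sub>j\<close>, \<open>B\<^sub>j\<close> for the left, right and pack operators, \<open>[L\<^sub>j, R\<^sub>j] = R\<^sub>j - B\<^sub>j\<close> and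
  \<open>[L\<^sub>j, R\<^bsub>j+1\<^esub>] = B\<^sub>j - R\<^bsub>j+1\<^esub>\<close>. The pack operators cancel, and with the rate \<open>j + 1\<close> in front of
  \<open>L\<^sub>j\<close> the sum over \<open>j\<close> of \<open>(j + 1) (R\<^sub>j - R\<^bsub>j+1\<^esub>)\<close> collapses to the sum of the \<open>R\<^sub>j\<close>.\<close>

definition pack_op :: "nat \<Rightarrow> ((nat \<Rightarrow> int) \<Rightarrow> real) \<Rightarrow> (nat \<Rightarrow> int) \<Rightarrow> real" where
  "pack_op j G X = G (X(j := X (Suc j) + 1)) - G X"

lemma sum_telescope_int:
  fixes g :: "int \<Rightarrow> real"
  assumes "a < b"
  shows "(\<Sum>z\<in>{a<..<b}. g (z + 1) - g z) = g b - g (a + 1)"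
proof -
  have "b = a + 1 + int (nat (b - a - 1))" using assms by simp
  moreover have "(\<Sum>z\<in>{a<..<a + 1 + int n}. g (z + 1) - g z) = g (a + 1 + int n) - g (a + 1)" for n
  proof (induction n)
    case (Suc n)
    have "{a<..<a + 1 + int (Suc n)} = insert (a + 1 + int n) {a<..<a + 1 + int n}" by auto
    then show ?case using Suc by (simp add: algebra_simps)
  next
    case 0
    have "{a<..<a + 1 + int 0} = {}" by auto
    then show ?case by simp
  qed
  ultimately show ?thesis by metis
qed

text \<open>With the other particles frozen, \<open>G\<close> is a function \<open>g\<close> of the
  position of particle \<open>j\<close>. A left jump followed by a right jump telescopes over the
  gap, and the ends of the telescope form the pack term. A right jump made first enlarges the gap by
  the site \<open>b\<close>, which leaves one copy of \<open>right_op j G X\<close> over.\<close>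

lemma commutator_same:
  assumes X: "X (Suc j) < X j" and X': "j = 0 \<or> X j < X (j - 1)"
  shows "left_op j (right_op j G) X - right_op j (left_op j G) X = right_op j G X - pack_op j G X"
proof -
  define a b where "a = X (Suc j)" and "b = X j"
  define g where "g z = G (X(j := z))" for z
  have gb: "G X = g b" by (simp add: g_def b_def)
  define S where "S = (\<Sum>z\<in>{a<..<b}. g z)"
  have ab: "a < b" using X by (simp add: a_def b_def)
  have n: "real (card {a<..<b}) = real_of_int (b - a - 1)" using ab by simp
  define C where "C \<longleftrightarrow> j = 0 \<or> b + 1 < X (j - 1)"
  have R: "right_op j G X = (if C then g (b + 1) - g b else 0)"
    by (simp add: right_op_def C_def g_def b_def)
  \<comment> \<open>After a left jump to \<open>z\<close> the site \<open>z + 1\<close> is at most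
    \<open>b\<close>, so the right jump is free even when it is blocked at \<open>b\<close>.\<close>
  have Rz: "right_op j G (X(j := z)) = g (z + 1) - g z" if "z \<in> {a<..<b}" for z
    using that X' by (auto simp: right_op_def g_def b_def)
  have "left_op j (right_op j G) X
      = (\<Sum>z\<in>{a<..<b}. (g (z + 1) - g z) - right_op j G X)"
    unfolding left_op_def a_def[symmetric] b_def[symmetric] by (intro sum.cong) (auto simp: Rz)
  also have "\<dots> = g b - g (a + 1) - (b - a - 1) * right_op j G X"
    using sum_telescope_int[OF ab, of g] n by (simp add: sum_subtractf)
  finally have LR: "left_op j (right_op j G) X = g b - g (a + 1) - (b - a - 1) * right_op j G X" .
  have L: "left_op j G X = S - (b - a - 1) * g b"
    unfolding left_op_def a_def[symmetric] b_def[symmetric] S_def using n gb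
    by (simp add: sum_subtractf g_def)
  have I: "{a<..<b + 1} = insert b {a<..<b}" using ab by auto
  have L': "left_op j G (X(j := b + 1)) = S + g b - (b - a) * g (b + 1)"
  proof -
    have "left_op j G (X(j := b + 1)) = (\<Sum>z\<in>{a<..<b + 1}. g z - g (b + 1))"
      unfolding left_op_def by (simp add: a_def g_def)
    then show ?thesis using n unfolding I
      by (simp add: sum_subtractf S_def algebra_simps)
  qed
  have RL: "right_op j (left_op j G) X = (if C then left_op j G (X(j := b + 1)) - left_op j G X else 0)"
    by (simp add: right_op_def C_def b_def)
  have P: "pack_op j G X = g (a + 1) - g b" by (simp add: pack_op_def g_def a_def b_def)
  show ?thesis unfolding LR RL L L' R P by (simp add: algebra_simps)
qed

text \<open>Two effects meet at the site \<open>a + 1\<close>: the right jump of particle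
  \<open>Suc j\<close> removes it from the gap of particle \<open>j\<close>, and a particle
  \<open>j\<close> standing there blocks that jump. Every other target site contributes the same in
  both orders. If the gap is empty, all terms vanish.\<close>

lemma commutator_Suc:
  assumes X: "X (Suc j) < X j"
  shows "left_op j (right_op (Suc j) G) X - right_op (Suc j) (left_op j G) X
    = pack_op j G X - right_op (Suc j) G X"
proof -
  define a b where "a = X (Suc j)" and "b = X j"
  define g where "g z = G (X(j := z))" for z
  define g' where "g' z = G (X(j := z, Suc j := a + 1))" for z
  have gb: "G X = g b" by (simp add: g_def b_def)
  have gb': "G (X(Suc j := a + 1)) = g' b" by (simp add: g'_def b_def)
  have g'': "G (X(Suc j := a + 1, j := z)) = g' z" for z
    unfolding g'_def by (simp add: fun_upd_twist)
  have ab: "a < b" using X by (simp add: a_def b_def)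
  have P: "pack_op j G X = g (a + 1) - g b" by (simp add: pack_op_def g_def a_def b_def)
  have R: "right_op (Suc j) G X = (if a + 1 < b then g' b - g b else 0)"
    by (simp add: right_op_def gb gb' a_def[symmetric] b_def[symmetric])
  have Rz: "right_op (Suc j) G (X(j := z)) = (if a + 1 < z then g' z - g z else 0)" for z
    by (simp add: right_op_def g'_def g_def a_def[symmetric])
  have L: "left_op j G X = (\<Sum>z\<in>{a<..<b}. g z - g b)"
    unfolding left_op_def by (simp add: a_def b_def g_def)
  have L': "left_op j G (X(Suc j := a + 1)) = (\<Sum>z\<in>{a + 1<..<b}. g' z - g' b)"
    unfolding left_op_def by (simp add: g'' gb' b_def[symmetric])
  have LR: "left_op j (right_op (Suc j) G) X
    = (\<Sum>z\<in>{a<..<b}. (if a + 1 < z then g' z - g z else 0) - right_op (Suc j) G X)"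
    unfolding left_op_def by (simp add: a_def[symmetric] b_def[symmetric] Rz)
  have RL: "right_op (Suc j) (left_op j G) X
    = (if a + 1 < b then left_op j G (X(Suc j := a + 1)) - left_op j G X else 0)"
    by (simp add: right_op_def a_def[symmetric] b_def[symmetric])
  show ?thesis
  proof (cases "a + 1 < b")
    case True
    define S where "S = (\<Sum>z\<in>{a + 1<..<b}. g z)"
    define S' where "S' = (\<Sum>z\<in>{a + 1<..<b}. g' z)"
    have n: "real (card {a + 1<..<b}) = real_of_int (b - a - 2)" using True by simp
    have I: "{a<..<b} = insert (a + 1) {a + 1<..<b}" using True by auto
    define d where "d = g' b - g b"
    have "(\<Sum>z\<in>{a + 1<..<b}. (if a + 1 < z then g' z - g z else 0) - d)
      = (\<Sum>z\<in>{a + 1<..<b}. g' z - g z - d)" by (intro sum.cong) auto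
    also have "\<dots> = S' - S - (b - a - 2) * d"
      using n by (simp only: sum_subtractf sum_constant S_def S'_def)
    finally have "left_op j (right_op (Suc j) G) X = S' - S - (b - a - 1) * (g' b - g b)"
      unfolding LR R I using True by (simp add: d_def[symmetric] algebra_simps)
    moreover have "left_op j G X = g (a + 1) + S - (b - a - 1) * g b"
      unfolding L I using n by (simp add: sum_subtractf S_def algebra_simps)
    moreover have "left_op j G (X(Suc j := a + 1)) = S' - (b - a - 2) * g' b"
      unfolding L' using n by (simp add: sum_subtractf S'_def algebra_simps)
    ultimately show ?thesis unfolding RL R P using True by (simp add: algebra_simps)
  next
    case False
    then have b: "b = a + 1" using ab by simp
    have "{a<..<b} = {}" using b by auto
    then show ?thesis unfolding LR RL R P using False b by simp
  qed
qed

text \<open>The gap of particle \<open>j\<close> is bounded by the particles \<open>j\<close> and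
  \<open>Suc j\<close>, and the exclusion condition of particle \<open>i\<close> reads only
  \<open>i\<close> and \<open>i - 1\<close>. For these indices neither move affects the
  other.\<close>

lemma commutator_far:
  assumes "i \<noteq> j" "i \<noteq> Suc j"
  shows "left_op j (right_op i G) X - right_op i (left_op j G) X = 0"
proof -
  have "i - 1 \<noteq> j \<or> i = 0" using assms by auto
  then have c: "(i = 0 \<or> (X(j := z)) i + 1 < (X(j := z)) (i - 1)) \<longleftrightarrow> (i = 0 \<or> X i + 1 < X (i - 1))" for z
    using assms by auto
  show ?thesis
  proof (cases "i = 0 \<or> X i + 1 < X (i - 1)")
    case True
    have "left_op j (right_op i G) X = (\<Sum>z\<in>{X (Suc j)<..<X j}.
        (G (X(i := X i + 1, j := z)) - G (X(j := z))) - (G (X(i := X i + 1)) - G X))"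
      using True assms c unfolding left_op_def right_op_def
      by (intro sum.cong) (auto simp: fun_upd_twist)
    moreover have "right_op i (left_op j G) X = (\<Sum>z\<in>{X (Suc j)<..<X j}.
        (G (X(i := X i + 1, j := z)) - G (X(i := X i + 1))) - (G (X(j := z)) - G X))"
    proof -
      have "right_op i (left_op j G) X = left_op j G (X(i := X i + 1)) - left_op j G X"
        using True by (auto simp: right_op_def)
      also have "\<dots> = (\<Sum>z\<in>{X (Suc j)<..<X j}. G (X(i := X i + 1, j := z)) - G (X(i := X i + 1)))
          - (\<Sum>z\<in>{X (Suc j)<..<X j}. G (X(j := z)) - G X)"
        using assms by (simp add: left_op_def)
      also have "\<dots> = (\<Sum>z\<in>{X (Suc j)<..<X j}.
          (G (X(i := X i + 1, j := z)) - G (X(i := X i + 1))) - (G (X(j := z)) - G X))"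
        by (rule sum_subtractf[symmetric])
      finally show ?thesis .
    qed
    ultimately have "left_op j (right_op i G) X = right_op i (left_op j G) X"
      by (auto intro!: sum.cong)
    then show ?thesis by simp
  next
    case False
    then show ?thesis using assms c unfolding left_op_def right_op_def by auto
  qed
qed

text \<open>Cutting the sums at \<open>M\<close> drops the commutator of \<open>left_op M\<close>
  with \<open>right_op (Suc M)\<close>, so one pack term is left over. It vanishes when the
  particles from \<open>M\<close> on are packed.\<close>

lemma commutator_sum:
  assumes X: "\<And>i j. i < j \<Longrightarrow> X j < X i"
  shows "(\<Sum>j<Suc M. \<Sum>i<Suc M. real (Suc j) * (left_op j (right_op i G) X - right_op i (left_op j G) X))
    = (\<Sum>j<Suc M. right_op j G X) - real (Suc M) * pack_op M G X"
proof -
  define c where "c j i = left_op j (right_op i G) X - right_op i (left_op j G) X" for i j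
  have c0: "c j j = right_op j G X - pack_op j G X" for j
    unfolding c_def by (rule commutator_same) (auto intro: X)
  have c1: "c j (Suc j) = pack_op j G X - right_op (Suc j) G X" for j
    unfolding c_def by (rule commutator_Suc) (auto intro: X)
  have c2: "c j i = 0" if "i \<noteq> j" "i \<noteq> Suc j" for i j
    unfolding c_def using that by (rule commutator_far)
  have "(\<Sum>j<Suc M. \<Sum>i<Suc M. real (Suc j) * c j i)
    = (\<Sum>j<Suc M. right_op j G X) - real (Suc M) * pack_op M G X"
  proof (induction M)
    case (Suc M)
    \<comment> \<open>Besides the diagonal entry, the new row is zero and the new column has a
      single entry, next to the diagonal, which cancels the pack term of the induction
      hypothesis.\<close>
    have row: "(\<Sum>i<Suc M. c (Suc M) i) = 0" by (intro sum.neutral) (auto intro!: c2)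
    have "(\<Sum>j<Suc M. real (Suc j) * c j (Suc M)) = (\<Sum>j\<in>{M}. real (Suc j) * c j (Suc M))"
      by (intro sum.mono_neutral_right) (auto intro!: c2)
    then have col: "(\<Sum>j<Suc M. real (Suc j) * c j (Suc M)) = real (Suc M) * c M (Suc M)" by simp
    have "(\<Sum>j<Suc (Suc M). \<Sum>i<Suc (Suc M). real (Suc j) * c j i)
      = (\<Sum>j<Suc M. \<Sum>i<Suc M. real (Suc j) * c j i) + (\<Sum>j<Suc M. real (Suc j) * c j (Suc M))
        + real (Suc (Suc M)) * (\<Sum>i<Suc M. c (Suc M) i) + real (Suc (Suc M)) * c (Suc M) (Suc M)"
      unfolding sum.lessThan_Suc[of _ "Suc M"] sum.distrib
      by (simp only: sum_distrib_left[symmetric] distrib_left add.assoc)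
    also have "\<dots> = (\<Sum>j<Suc (Suc M). right_op j G X) - real (Suc (Suc M)) * pack_op (Suc M) G X"
      unfolding Suc col row c0 c1 sum.lessThan_Suc[of _ "Suc M"]
      by (simp add: algebra_simps)
    finally show ?case .
  qed (simp add: c0)
  then show ?thesis by (simp add: c_def)
qed


section \<open>The generators in particle coordinates\<close>

definition packed :: "nat \<Rightarrow> (nat \<Rightarrow> int) \<Rightarrow> bool" where
  "packed n X \<longleftrightarrow> (\<forall>j\<ge>n. X j = - int j - 1)"

definition jumps :: "config \<Rightarrow> int set" where
  "jumps \<eta> = {x. \<eta> x \<and> \<not> \<eta> (x + 1)}"

lemma packedD: "packed n X \<Longrightarrow> n \<le> j \<Longrightarrow> X j = - int j - 1"
  by (simp add: packed_def)

lemma packed_mono: "packed n X \<Longrightarrow> n \<le> m \<Longrightarrow> packed m X"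
  by (simp add: packed_def)

lemma packed_upd: "packed n X \<Longrightarrow> j < n \<Longrightarrow> packed n (X(j := z))"
  by (auto simp: packed_def)

lemma decreasing_Suc:
  fixes X :: "nat \<Rightarrow> int"
  assumes "\<And>j. X (Suc j) < X j" and "i < j"
  shows "X j < X i"
  using lift_Suc_mono_less[of "\<lambda>j. - X j" i j] assms by simp

lemma particle_seqsI:
  assumes "\<And>j. X (Suc j) < X j" and "packed n X"
  shows "X \<in> particle_seqs"
  using decreasing_Suc[of X] assms by (auto simp: particle_seqs_def packed_def)

lemma particle_seqs_less: "X \<in> particle_seqs \<Longrightarrow> i < j \<Longrightarrow> X j < X i"
  by (simp add: particle_seqs_def)

lemma particle_seqs_le: "X \<in> particle_seqs \<Longrightarrow> i \<le> j \<Longrightarrow> X j \<le> X i"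
  using particle_seqs_less[of X i j] by (cases "i = j") auto

lemma particle_seqs_inj: "X \<in> particle_seqs \<Longrightarrow> inj X"
  by (metis (no_types, lifting) injI linorder_neqE_nat order_less_irrefl particle_seqs_less)

lemma particle_seqs_packed:
  assumes "X \<in> particle_seqs"
  obtains n where "packed n X"
  using assms by (auto simp: particle_seqs_def packed_def)

lemma particle_seqs_not_range:
  assumes "X \<in> particle_seqs" "X (Suc j) < z" "j = 0 \<or> z < X (j - 1)" "z \<noteq> X j"
  shows "z \<notin> range X"
proof
  assume "z \<in> range X"
  then obtain i where i: "z = X i" by auto
  consider "i < j" | "i = j" | "i > j" by linarith
  then show False
  proof cases
    case 1
    then have "i \<le> j - 1" "j \<noteq> 0" by auto
    then show False using assms i particle_seqs_le[of X i "j - 1"] by auto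
  next
    case 3
    then show False using assms i particle_seqs_le[of X "Suc j" i] by auto
  qed (use assms i in auto)
qed

lemma particle_seqs_upd:
  assumes X: "X \<in> particle_seqs" and z: "X (Suc j) < z" "j = 0 \<or> z < X (j - 1)"
  shows "X(j := z) \<in> particle_seqs"
proof -
  obtain n where n: "packed n X" using X by (rule particle_seqs_packed)
  have "packed (max n (Suc j)) (X(j := z))" using n by (auto simp: packed_def)
  moreover have "(X(j := z)) (Suc k) < (X(j := z)) k" for k
    using z particle_seqs_less[OF X, of k "Suc k"] by auto
  ultimately show ?thesis by (intro particle_seqsI)
qed

lemma move_config_of:
  assumes "X \<in> particle_seqs" "z \<notin> range X"
  shows "move (config_of X) (X j) z = config_of (X(j := z))"
proof
  fix x
  show "move (config_of X) (X j) z x = config_of (X(j := z)) x"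
    using assms particle_seqs_inj[OF assms(1)] by (auto simp: move_def config_of_def inj_eq image_iff)
qed

lemma configs_eq: "configs = config_of ` particle_seqs"
proof (intro equalityI subsetI)
  fix \<eta> assume "\<eta> \<in> configs"
  then obtain x :: "nat \<Rightarrow> int" where x: "\<And>i j. 1 \<le> i \<Longrightarrow> i < j \<Longrightarrow> x j < x i"
    "{z. \<eta> z} = x ` {1..}" "\<forall>\<^sub>F N in sequentially. x N = - int N"
    unfolding configs_def by blast
  then obtain n where n: "\<And>N. N \<ge> n \<Longrightarrow> x N = - int N" by (auto simp: eventually_sequentially)
  define X where "X j = x (Suc j)" for j
  have "packed n X" using n by (auto simp: packed_def X_def)
  then have "X \<in> particle_seqs" using x(1) by (intro particle_seqsI) (auto simp: X_def)
  moreover have "range X = x ` {1..}"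
  proof -
    have "{1..} = range Suc" by (metis One_nat_def atLeast_Suc_greaterThan greaterThan_0)
    then show ?thesis by (auto simp: X_def image_image)
  qed
  then have "\<eta> = config_of X" using x(2) by (auto simp: config_of_def fun_eq_iff)
  ultimately show "\<eta> \<in> config_of ` particle_seqs" by blast
next
  fix \<eta> assume "\<eta> \<in> config_of ` particle_seqs"
  then obtain X where X: "X \<in> particle_seqs" "\<eta> = config_of X" by blast
  obtain n where n: "packed n X" using X by (auto elim: particle_seqs_packed)
  define x where "x j = X (j - 1)" for j
  have "range X = x ` {1..}"
  proof -
    have "{1..} = range Suc" by (metis One_nat_def atLeast_Suc_greaterThan greaterThan_0)
    then show ?thesis by (auto simp: x_def image_image)
  qed
  then have "{z. \<eta> z} = x ` {1..}" by (auto simp: X config_of_def)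
  moreover have "x N = - int N" if "N \<ge> Suc n" for N
    using packedD[OF n, of "N - 1"] that by (auto simp: x_def of_nat_diff)
  then have "\<forall>\<^sub>F N in sequentially. x N = - int N" by (auto simp: eventually_sequentially)
  ultimately show "\<eta> \<in> configs"
    unfolding configs_def using particle_seqs_less[OF X(1)] by (auto simp: x_def intro!: exI[of _ x])
qed

section \<open>Both generators as finite sums over particles\<close>

lemma tasep_gen_jumps:
  assumes "finite (jumps \<eta>)"
  shows "tasep_gen g \<eta> = (\<Sum>x\<in>jumps \<eta>. g (move \<eta> x (x + 1)) - g \<eta>)"
proof -
  have "tasep_gen g \<eta> = (\<Sum>\<^sub>\<infinity>x\<in>jumps \<eta>. g (move \<eta> x (x + 1)) - g \<eta>)"
    unfolding tasep_gen_def by (rule infsum_cong_neutral) (auto simp: jumps_def)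
  then show ?thesis using assms by simp
qed

text \<open>Particle \<open>n\<close> may still have a hole in front of it, because its exclusion
  condition reads \<open>X (n - 1)\<close>; only from \<open>Suc n\<close> on are all particles
  blocked. Hence the strict bound \<open>n < M\<close>. The left jumps look at
  \<open>X (Suc j)\<close> instead and are impossible from \<open>n\<close> on.\<close>

lemma jumps_config_of:
  assumes X: "X \<in> particle_seqs" and n: "packed n X" "n < M"
  shows "jumps (config_of X) = X ` {j\<in>{..<M}. j = 0 \<or> X j + 1 < X (j - 1)}"
proof (intro equalityI subsetI)
  fix x assume "x \<in> jumps (config_of X)"
  then obtain j where j: "x = X j" "X j + 1 \<notin> range X" by (auto simp: jumps_def config_of_def)
  have "j = 0 \<or> X j + 1 < X (j - 1)"
  proof (cases "j = 0")
    case False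
    have "X j + 1 \<noteq> X (j - 1)" using j(2) by (metis rangeI)
    then show ?thesis using False particle_seqs_less[OF X, of "j - 1" j] by auto
  qed simp
  moreover have "j < M"
  proof (rule ccontr)
    assume "\<not> j < M"
    then have "X (j - 1) = X j + 1"
      using packedD[OF n(1), of j] packedD[OF n(1), of "j - 1"] n(2) by (simp add: of_nat_diff)
    then show False using j(2) by (metis rangeI)
  qed
  ultimately show "x \<in> X ` {j\<in>{..<M}. j = 0 \<or> X j + 1 < X (j - 1)}" using j by blast
next
  fix x assume "x \<in> X ` {j\<in>{..<M}. j = 0 \<or> X j + 1 < X (j - 1)}"
  then obtain j where j: "x = X j" "j = 0 \<or> X j + 1 < X (j - 1)" by blast
  then have "X j + 1 \<notin> range X"
    using particle_seqs_less[OF X, of j "Suc j"] by (intro particle_seqs_not_range[OF X]) auto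
  then show "x \<in> jumps (config_of X)" using j by (simp add: jumps_def config_of_def)
qed

lemma tasep_gen_config_of:
  assumes X: "X \<in> particle_seqs" and n: "packed n X" "n < M"
  shows "tasep_gen g (config_of X) = (\<Sum>j<M. right_op j (\<lambda>X. g (config_of X)) X)"
proof -
  define A where "A = {j\<in>{..<M}. j = 0 \<or> X j + 1 < X (j - 1)}"
  have J: "jumps (config_of X) = X ` A" unfolding A_def using assms by (rule jumps_config_of)
  have "finite A" by (simp add: A_def)
  have mv: "move (config_of X) (X j) (X j + 1) = config_of (X(j := X j + 1))" if "j \<in> A" for j
    using that particle_seqs_less[OF X, of j "Suc j"]
    by (intro move_config_of[OF X] particle_seqs_not_range[OF X]) (auto simp: A_def)
  have "tasep_gen g (config_of X) = (\<Sum>j\<in>A. g (move (config_of X) (X j) (X j + 1)) - g (config_of X))"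
    using \<open>finite A\<close> particle_seqs_inj[OF X]
    by (subst tasep_gen_jumps) (simp_all add: J sum.reindex inj_on_subset[of X UNIV])
  also have "\<dots> = (\<Sum>j\<in>A. g (config_of (X(j := X j + 1))) - g (config_of X))"
    by (intro sum.cong) (auto simp: mv)
  also have "\<dots> = (\<Sum>j<M. right_op j (\<lambda>X. g (config_of X)) X)"
    unfolding A_def right_op_def by (subst sum.inter_filter) (auto intro!: sum.cong)
  finally show ?thesis .
qed

text \<open>The product is the indicator of an empty path: it is 1 until \<open>m\<close> reaches
  the distance \<open>d\<close> to the next particle and 0 from then on, because the factor
  \<open>k = d\<close> vanishes. So \<open>m\<close> effectively runs over the sites of the
  gap.\<close>

lemma hammersley_inner:
  assumes X: "X \<in> particle_seqs"
  shows "(\<Sum>\<^sub>\<infinity>m\<in>{1::nat..}. (\<Prod>k=1..m. 1 - occ (config_of X) (X j - int k)) *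
      (g (move (config_of X) (X j) (X j - int m)) - g (config_of X))) = left_op j (\<lambda>X. g (config_of X)) X"
proof -
  define d where "d = nat (X j - X (Suc j))"
  have d: "int d = X j - X (Suc j)" using particle_seqs_less[OF X, of j "Suc j"] by (simp add: d_def)
  have hole: "\<not> config_of X (X j - int k)" if "k \<in> {1..<d}" for k
    unfolding config_of_def
  proof (rule particle_seqs_not_range[OF X, of j])
    show "j = 0 \<or> X j - int k < X (j - 1)"
      using particle_seqs_less[OF X, of "j - 1" j] by (cases "j = 0") auto
  qed (use that d in auto)
  have p1: "(\<Prod>k=1..m. 1 - occ (config_of X) (X j - int k)) = 1" if "m \<in> {1..<d}" for m
    using that hole by (intro prod.neutral) auto
  have "config_of X (X j - int d)" using d by (simp add: config_of_def)
  then have p0: "(\<Prod>k=1..m. 1 - occ (config_of X) (X j - int k)) = 0" if "m \<ge> d" "1 \<le> m" for m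
    using that d particle_seqs_less[OF X, of j "Suc j"] by (intro prod_zero) (auto intro!: bexI[of _ d])
  have "(\<Sum>\<^sub>\<infinity>m\<in>{1::nat..}. (\<Prod>k=1..m. 1 - occ (config_of X) (X j - int k)) *
      (g (move (config_of X) (X j) (X j - int m)) - g (config_of X)))
    = (\<Sum>\<^sub>\<infinity>m\<in>{1..<d}. g (move (config_of X) (X j) (X j - int m)) - g (config_of X))"
    using p0 p1 by (intro infsum_cong_neutral) auto
  also have "\<dots> = (\<Sum>m\<in>{1..<d}. g (config_of (X(j := X j - int m))) - g (config_of X))"
    unfolding infsum_finite[OF finite_atLeastLessThan]
    using hole by (intro sum.cong refl) (simp add: move_config_of[OF X] config_of_def[THEN fun_cong])
  also have "\<dots> = left_op j (\<lambda>X. g (config_of X)) X"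
    unfolding left_op_def
    by (intro sum.reindex_bij_witness[of _ "\<lambda>z. nat (X j - z)" "\<lambda>m. X j - int m"]) (use d in auto)
  finally show ?thesis .
qed

lemma count_right_config_of:
  assumes X: "X \<in> particle_seqs"
  shows "(\<Sum>\<^sub>\<infinity>y\<in>{X j..}. occ (config_of X) y) = real (Suc j)"
proof -
  have "(\<Sum>\<^sub>\<infinity>y\<in>{X j..}. occ (config_of X) y) = (\<Sum>\<^sub>\<infinity>y\<in>X ` {..j}. 1 :: real)"
  proof (rule infsum_cong_neutral)
    fix y assume "y \<in> {X j..} - X ` {..j}"
    then show "occ (config_of X) y = 0"
      using particle_seqs_less[OF X, of j] by (auto simp: config_of_def) (metis atMost_iff image_eqI linorder_not_le)
  qed (use particle_seqs_le[OF X] in \<open>auto simp: config_of_def\<close>)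
  also have "\<dots> = real (Suc j)"
    using card_image[OF inj_on_subset[OF particle_seqs_inj[OF X] subset_UNIV], of "{..j}"] by simp
  finally show ?thesis .
qed

lemma left_op_packed:
  assumes "packed n X" "n \<le> j"
  shows "left_op j G X = 0"
proof -
  have "{X (Suc j)<..<X j} = {}"
    using packedD[OF assms] packedD[OF assms(1), of "Suc j"] assms(2) by auto
  then show ?thesis unfolding left_op_def by simp
qed

lemma hammersley_gen_config_of:
  assumes X: "X \<in> particle_seqs" and n: "packed n X" "n \<le> M"
  shows "hammersley_gen g (config_of X) = (\<Sum>j<M. real (Suc j) * left_op j (\<lambda>X. g (config_of X)) X)"
proof -
  define F where "F x = occ (config_of X) x * (\<Sum>\<^sub>\<infinity>y\<in>{x..}. occ (config_of X) y) *
      (\<Sum>\<^sub>\<infinity>m\<in>{1::nat..}. (\<Prod>k=1..m. 1 - occ (config_of X) (x - int k)) *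
        (g (move (config_of X) x (x - int m)) - g (config_of X)))" for x
  have F: "F (X j) = real (Suc j) * left_op j (\<lambda>X. g (config_of X)) X" for j
    unfolding F_def count_right_config_of[OF X] hammersley_inner[OF X] by (simp add: config_of_def)
  have "hammersley_gen g (config_of X) = (\<Sum>\<^sub>\<infinity>x\<in>UNIV. F x)"
    by (simp add: hammersley_gen_def F_def)
  also have "\<dots> = (\<Sum>\<^sub>\<infinity>x\<in>X ` {..<M}. F x)"
  proof (rule infsum_cong_neutral)
    fix x assume x: "x \<in> UNIV - X ` {..<M}"
    show "F x = 0"
    proof (cases "x \<in> range X")
      case True
      then obtain j where j: "x = X j" by blast
      then have "M \<le> j" using x by force
      then show ?thesis using n by (simp add: j F left_op_packed[of n])
    qed (simp add: F_def config_of_def)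
  qed auto
  also have "\<dots> = (\<Sum>j<M. F (X j))"
    using particle_seqs_inj[OF X] by (simp add: sum.reindex inj_on_subset[of X UNIV])
  finally show ?thesis by (simp add: F)
qed


section \<open>The commutation relation of the two generators\<close>

lemma right_cond_le:
  assumes "packed n X" "i = 0 \<or> X i + 1 < X (i - 1)"
  shows "i \<le> n"
proof (rule ccontr)
  assume "\<not> i \<le> n"
  then have "n \<le> i" "n \<le> i - 1" "i > 0" by auto
  then show False
    using assms(2) packedD[OF assms(1), of i] packedD[OF assms(1), of "i - 1"] by (simp add: of_nat_diff)
qed

lemma generators_commute:
  assumes "\<eta> \<in> configs"
  shows "tasep_gen (hammersley_gen g) \<eta> = hammersley_gen (tasep_gen g) \<eta> - tasep_gen g \<eta>"
proof -
  obtain X where X: "X \<in> particle_seqs" and \<eta>: "\<eta> = config_of X" using assms by (auto simp: configs_eq)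
  obtain n where n: "packed n X" using X by (rule particle_seqs_packed)
  \<comment> \<open>A right jump of particle \<open>n\<close> destroys packing from \<open>n\<close>
    on but keeps it from \<open>Suc n\<close> on, so one more index keeps the finite sums valid
    after the jump.\<close>
  define N where "N = Suc n"
  define G where "G X = g (config_of X)" for X
  have H: "hammersley_gen g (config_of Y) = (\<Sum>j<Suc N. real (Suc j) * left_op j G Y)"
    if "Y \<in> particle_seqs" "packed N Y" for Y
    unfolding G_def by (rule hammersley_gen_config_of[OF that]) simp
  have R: "right_op i (\<lambda>X. hammersley_gen g (config_of X)) X
      = (\<Sum>j<Suc N. real (Suc j) * right_op i (left_op j G) X)" for i
  proof (cases "i = 0 \<or> X i + 1 < X (i - 1)")
    case True
    have "i \<le> n" using n True by (rule right_cond_le)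
    then have "packed N (X(i := X i + 1))"
      using packed_mono[OF n, of N] by (intro packed_upd) (auto simp: N_def)
    moreover have "X(i := X i + 1) \<in> particle_seqs"
      using True particle_seqs_less[OF X, of i "Suc i"] by (intro particle_seqs_upd[OF X]) auto
    ultimately have H': "hammersley_gen g (config_of (X(i := X i + 1)))
        = (\<Sum>j<Suc N. real (Suc j) * left_op j G (X(i := X i + 1)))" by (intro H)
    have "packed N X" using packed_mono[OF n, of N] by (simp add: N_def)
    note H0 = H[OF X this]
    have "right_op i (\<lambda>X. hammersley_gen g (config_of X)) X
        = hammersley_gen g (config_of (X(i := X i + 1))) - hammersley_gen g (config_of X)"
      using True by (auto simp: right_op_def)
    also have "\<dots> = (\<Sum>j<Suc N. real (Suc j) * (left_op j G (X(i := X i + 1)) - left_op j G X))"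
      by (simp only: H' H0 sum_subtractf right_diff_distrib)
    also have "\<dots> = (\<Sum>j<Suc N. real (Suc j) * right_op i (left_op j G) X)"
      using True by (intro sum.cong refl) (auto simp: right_op_def)
    finally show ?thesis .
  qed (auto simp: right_op_def)
  \<comment> \<open>For \<open>j < n\<close> a left jump does not touch the packed tail, so the same
    finite sum represents \<open>tasep_gen\<close> after it; for larger \<open>j\<close> the gap is
    empty and both sides vanish.\<close>
  have L: "left_op j (\<lambda>X. tasep_gen g (config_of X)) X = (\<Sum>i<Suc N. left_op j (right_op i G) X)" for j
  proof (cases "j < n")
    case True
    have T: "tasep_gen g (config_of Y) = (\<Sum>i<Suc N. right_op i G Y)" if "Y \<in> particle_seqs" "packed n Y" for Y
      unfolding G_def by (rule tasep_gen_config_of[OF that]) (simp add: N_def)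
    have T': "tasep_gen g (config_of (X(j := z))) = (\<Sum>i<Suc N. right_op i G (X(j := z)))"
      if "z \<in> {X (Suc j)<..<X j}" for z
    proof (rule T)
      have "j = 0 \<or> z < X (j - 1)"
        using that particle_seqs_less[OF X, of "j - 1" j] by (cases "j = 0") auto
      then show "X(j := z) \<in> particle_seqs" using that by (intro particle_seqs_upd[OF X]) auto
      show "packed n (X(j := z))" using n True by (rule packed_upd)
    qed
    have "left_op j (\<lambda>X. tasep_gen g (config_of X)) X
      = (\<Sum>z\<in>{X (Suc j)<..<X j}. \<Sum>i<Suc N. right_op i G (X(j := z)) - right_op i G X)"
      unfolding left_op_def
      by (intro sum.cong refl) (simp only: T' T[OF X n] sum_subtractf)
    also have "\<dots> = (\<Sum>i<Suc N. left_op j (right_op i G) X)"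
      unfolding left_op_def by (rule sum.swap)
    finally show ?thesis .
  next
    case False
    then show ?thesis using left_op_packed[OF n] by simp
  qed
  \<comment> \<open>Particle \<open>N\<close> lies in the packed tail and already sits next to its
    left neighbour, so the boundary term of \<open>commutator_sum\<close> disappears.\<close>
  have "pack_op N G X = 0"
  proof -
    have "X(N := X (Suc N) + 1) = X"
      using packedD[OF n, of N] packedD[OF n, of "Suc N"] by (auto simp: N_def)
    then show ?thesis by (simp add: pack_op_def)
  qed
  then have c: "(\<Sum>j<Suc N. \<Sum>i<Suc N. real (Suc j) * (left_op j (right_op i G) X - right_op i (left_op j G) X))
      = (\<Sum>j<Suc N. right_op j G X)"
    using commutator_sum[where M = N and G = G, of X] particle_seqs_less[OF X] by simp
  have "tasep_gen (hammersley_gen g) \<eta>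
      = (\<Sum>i<Suc N. \<Sum>j<Suc N. real (Suc j) * right_op i (left_op j G) X)"
    unfolding \<eta> R[symmetric] by (rule tasep_gen_config_of[OF X n]) (simp add: N_def)
  also have "\<dots> = (\<Sum>j<Suc N. \<Sum>i<Suc N. real (Suc j) * right_op i (left_op j G) X)"
    by (rule sum.swap)
  also have "\<dots> = (\<Sum>j<Suc N. \<Sum>i<Suc N. real (Suc j) * left_op j (right_op i G) X)
      - (\<Sum>j<Suc N. right_op j G X)"
    unfolding c[symmetric] by (simp only: right_diff_distrib sum_subtractf diff_diff_eq2 add_diff_cancel_left')
  also have "(\<Sum>j<Suc N. \<Sum>i<Suc N. real (Suc j) * left_op j (right_op i G) X)
      = hammersley_gen (tasep_gen g) \<eta>"
    unfolding \<eta> sum_distrib_left[symmetric] L[symmetric]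
    by (rule hammersley_gen_config_of[OF X n, symmetric]) (simp add: N_def)
  also have "(\<Sum>j<Suc N. right_op j G X) = tasep_gen g \<eta>"
    unfolding \<eta> G_def by (rule tasep_gen_config_of[OF X n, symmetric]) (simp add: N_def)
  finally show ?thesis .
qed

section \<open>The area of a configuration\<close>

definition inversions :: "config \<Rightarrow> (int \<times> int) set" where
  "inversions \<eta> = {(a, b). a < b \<and> \<not> \<eta> a \<and> \<eta> b}"

text \<open>For a configuration in \<open>configs\<close> this is the number of boxes of the Young
  diagram that it encodes. Elsewhere \<open>inversions\<close> may be infinite, and
  \<open>card\<close> then gives 0.\<close>

definition area :: "config \<Rightarrow> nat" where
  "area \<eta> = card (inversions \<eta>)"

definition agrees_outside :: "nat \<Rightarrow> config \<Rightarrow> bool" where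
  "agrees_outside N \<eta> \<longleftrightarrow> (\<forall>x. (x < - int N \<longrightarrow> \<eta> x) \<and> (x > int N \<longrightarrow> \<not> \<eta> x))"

text \<open>Replacing the exterior by the step profile can change the balance of particles and
  holes, so the result may lie outside \<open>configs\<close>.\<close>

definition trunc :: "nat \<Rightarrow> config \<Rightarrow> config" where
  "trunc N \<eta> = (\<lambda>x. if - int N \<le> x \<and> x \<le> int N then \<eta> x else x < 0)"

lemma agrees_outside_left: "agrees_outside N \<eta> \<Longrightarrow> x < - int N \<Longrightarrow> \<eta> x"
  and agrees_outside_right: "agrees_outside N \<eta> \<Longrightarrow> x > int N \<Longrightarrow> \<not> \<eta> x"
  by (simp_all add: agrees_outside_def)

lemma agrees_outside_mono: "agrees_outside M \<eta> \<Longrightarrow> M \<le> N \<Longrightarrow> agrees_outside N \<eta>"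
  unfolding agrees_outside_def by (meson less_le_trans le_less_trans neg_le_iff_le of_nat_mono)

lemma agrees_outside_trunc: "agrees_outside N (trunc N \<eta>)"
  by (auto simp: agrees_outside_def trunc_def)

lemma trunc_eq: "agrees_outside N \<eta> \<Longrightarrow> trunc N \<eta> = \<eta>"
  by (fastforce simp: agrees_outside_def trunc_def fun_eq_iff)

lemma configs_agrees_outside:
  assumes "\<eta> \<in> configs"
  obtains N where "agrees_outside N \<eta>"
proof -
  obtain X where X: "X \<in> particle_seqs" and \<eta>: "\<eta> = config_of X" using assms by (auto simp: configs_eq)
  obtain n where n: "packed n X" using X by (rule particle_seqs_packed)
  have "\<eta> x" if "x < - int n" for x
    using packedD[OF n, of "nat (- x - 1)"] that unfolding \<eta> config_of_def
    by (intro range_eqI[of _ _ "nat (- x - 1)"]) auto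
  moreover have "\<not> \<eta> x" if "x > int (nat \<bar>X 0\<bar>)" for x
  proof
    assume "\<eta> x"
    then obtain j where "x = X j" by (auto simp: \<eta> config_of_def)
    then show False using that particle_seqs_le[OF X, of 0 j] by simp
  qed
  ultimately have "agrees_outside (max n (nat \<bar>X 0\<bar>)) \<eta>" by (auto simp: agrees_outside_def)
  then show ?thesis by (rule that)
qed

lemma finite_inversions:
  assumes "agrees_outside N \<eta>" shows "finite (inversions \<eta>)"
proof (rule finite_subset)
  have "- int N \<le> a" if "\<not> \<eta> a" for a using assms that by (force simp: agrees_outside_def)
  moreover have "b \<le> int N" if "\<eta> b" for b using assms that by (force simp: agrees_outside_def)
  ultimately show "inversions \<eta> \<subseteq> {- int N..int N} \<times> {- int N..int N}"
    unfolding inversions_def by force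
qed simp

lemma finite_jumps:
  assumes "agrees_outside N \<eta>" shows "finite (jumps \<eta>)"
proof (rule finite_subset)
  have "- int N \<le> a" if "\<not> \<eta> a" for a using assms that by (force simp: agrees_outside_def)
  moreover have "b \<le> int N" if "\<eta> b" for b using assms that by (force simp: agrees_outside_def)
  ultimately show "jumps \<eta> \<subseteq> {- int N - 1..int N}"
    unfolding jumps_def by force
qed simp

text \<open>Pair the rightmost mobile particle \<open>m\<close> with the hole in front of every
  other mobile particle. Each pair is an inversion, and only \<open>m\<close> itself is left
  out.\<close>

lemma card_jumps_le:
  assumes "agrees_outside N \<eta>" shows "card (jumps \<eta>) \<le> Suc (area \<eta>)"
proof (cases "jumps \<eta> = {}")
  case False
  have fin: "finite (jumps \<eta>)" using assms by (rule finite_jumps)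
  define m where "m = Max (jumps \<eta>)"
  have m: "m \<in> jumps \<eta>" "\<And>x. x \<in> jumps \<eta> \<Longrightarrow> x \<le> m"
    using fin False by (auto simp: m_def)
  have "(x + 1, m) \<in> inversions \<eta>" if "x \<in> jumps \<eta> - {m}" for x
  proof -
    have "x < m" using that m(2)[of x] by auto
    moreover have "x + 1 \<noteq> m" using that m(1) by (auto simp: jumps_def)
    ultimately show ?thesis using that m(1) by (auto simp: jumps_def inversions_def)
  qed
  then have "card (jumps \<eta> - {m}) \<le> area \<eta>"
    unfolding area_def using finite_inversions[OF assms]
    by (intro card_inj_on_le[of "\<lambda>x. (x + 1, m)"]) (auto simp: inj_on_def)
  then show ?thesis using fin m(1) by (simp add: card_Diff_singleton_if)
qed simp

text \<open>The jump composes \<open>\<eta>\<close> with the transposition \<open>\<sigma>\<close>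
  of \<open>x\<close> and \<open>x + 1\<close>. A transposition of neighbours preserves the order of
  all pairs except this one, which becomes the only new inversion.\<close>

lemma area_move:
  assumes N: "agrees_outside N \<eta>" and x: "x \<in> jumps \<eta>"
  shows "area (move \<eta> x (x + 1)) = Suc (area \<eta>)"
proof -
  define \<sigma> where "\<sigma> y = (if y = x then x + 1 else if y = x + 1 then x else y)" for y
  have \<sigma>\<sigma>: "\<sigma> (\<sigma> y) = y" for y by (auto simp: \<sigma>_def)
  have \<sigma>_inj: "\<sigma> a = \<sigma> b \<longleftrightarrow> a = b" for a b by (metis \<sigma>\<sigma>)
  have mv: "move \<eta> x (x + 1) y = \<eta> (\<sigma> y)" for y
    using x by (auto simp: move_def \<sigma>_def jumps_def)
  have ord: "\<sigma> a < \<sigma> b \<longleftrightarrow> a < b" if "(a, b) \<noteq> (x, x + 1)" "(a, b) \<noteq> (x + 1, x)" for a b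
    using that by (auto simp: \<sigma>_def)
  have "inversions (move \<eta> x (x + 1)) = insert (x, x + 1) ((\<lambda>(a, b). (\<sigma> a, \<sigma> b)) ` inversions \<eta>)"
  proof (intro equalityI subsetI)
    fix p assume p: "p \<in> inversions (move \<eta> x (x + 1))"
    obtain a b where ab: "p = (a, b)" by force
    show "p \<in> insert (x, x + 1) ((\<lambda>(a, b). (\<sigma> a, \<sigma> b)) ` inversions \<eta>)"
    proof (cases "(a, b) = (x, x + 1)")
      case False
      have "(\<sigma> a, \<sigma> b) \<in> inversions \<eta>"
        using p ab False ord[of a b] by (auto simp: inversions_def mv)
      then have "(\<sigma> (\<sigma> a), \<sigma> (\<sigma> b)) \<in> (\<lambda>(a, b). (\<sigma> a, \<sigma> b)) ` inversions \<eta>" by force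
      then show ?thesis by (simp add: \<sigma>\<sigma> ab)
    qed (simp add: ab)
  next
    fix p assume "p \<in> insert (x, x + 1) ((\<lambda>(a, b). (\<sigma> a, \<sigma> b)) ` inversions \<eta>)"
    then consider "p = (x, x + 1)" | a b where "p = (\<sigma> a, \<sigma> b)" "(a, b) \<in> inversions \<eta>" by auto
    then show "p \<in> inversions (move \<eta> x (x + 1))"
    proof cases
      case 2
      then have "(a, b) \<noteq> (x, x + 1)" "(a, b) \<noteq> (x + 1, x)"
        using x by (auto simp: inversions_def jumps_def)
      then show ?thesis using 2 ord[of a b] by (auto simp: inversions_def mv \<sigma>\<sigma>)
    qed (use x in \<open>auto simp: inversions_def move_def\<close>)
  qed
  moreover have "(x, x + 1) \<notin> (\<lambda>(a, b). (\<sigma> a, \<sigma> b)) ` inversions \<eta>"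
  proof
    assume "(x, x + 1) \<in> (\<lambda>(a, b). (\<sigma> a, \<sigma> b)) ` inversions \<eta>"
    then obtain a b where "(a, b) \<in> inversions \<eta>" "\<sigma> a = x" "\<sigma> b = x + 1" by force
    then show False using \<sigma>\<sigma>[of a] \<sigma>\<sigma>[of b] by (auto simp: inversions_def \<sigma>_def)
  qed
  moreover have "card ((\<lambda>(a, b). (\<sigma> a, \<sigma> b)) ` inversions \<eta>) = card (inversions \<eta>)"
    by (rule card_image) (auto simp: inj_on_def \<sigma>_inj)
  ultimately show ?thesis using finite_inversions[OF N] by (simp add: area_def)
qed

lemma configs_move:
  assumes "\<eta> \<in> configs" "x \<in> jumps \<eta>"
  shows "move \<eta> x (x + 1) \<in> configs"
proof -
  obtain X where X: "X \<in> particle_seqs" and \<eta>: "\<eta> = config_of X" using assms by (auto simp: configs_eq)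
  obtain n where n: "packed n X" using X by (rule particle_seqs_packed)
  obtain j where j: "x = X j" "j = 0 \<or> X j + 1 < X (j - 1)"
    using jumps_config_of[OF X n lessI] assms(2) by (auto simp: \<eta>)
  have "move \<eta> x (x + 1) = config_of (X(j := X j + 1))"
    using assms(2) unfolding \<eta> j(1) by (intro move_config_of[OF X]) (auto simp: jumps_def config_of_def)
  moreover have "X(j := X j + 1) \<in> particle_seqs"
    using j(2) particle_seqs_less[OF X, of j "Suc j"] by (intro particle_seqs_upd[OF X]) auto
  ultimately show ?thesis by (auto simp: configs_eq)
qed

section \<open>Growth of the generators in terms of the area\<close>

lemma hammersley_gen_bound:
  assumes g: "\<And>\<zeta>. \<zeta> \<in> configs \<Longrightarrow> \<bar>g \<zeta>\<bar> \<le> B" and "\<eta> \<in> configs"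
  shows "\<bar>hammersley_gen g \<eta>\<bar> \<le> 2 * B * real (area \<eta>)"
proof -
  obtain X where X: "X \<in> particle_seqs" and \<eta>: "\<eta> = config_of X" using assms by (auto simp: configs_eq)
  obtain n where n: "packed n X" using X by (rule particle_seqs_packed)
  obtain N where N: "agrees_outside N \<eta>" using assms(2) by (rule configs_agrees_outside)
  have B: "0 \<le> B" using g[OF assms(2)] by linarith
  define I where "I j = {X (Suc j)<..<X j}" for j
  \<comment> \<open>The size of \<open>A\<close> is the total rate of \<open>hammersley_gen\<close>
    at \<open>\<eta>\<close>: \<open>i \<le> j\<close> accounts for the factor \<open>j + 1\<close>
    and \<open>z\<close> for the target sites. Each triple yields the inversion formed by the hole
    \<open>z\<close> and the particle \<open>X i\<close>; since \<open>z\<close> determines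
    \<open>j\<close>, the rate is at most the area.\<close>
  define A where "A = (SIGMA j:{..<n}. {..j} \<times> I j)"
  have "\<bar>left_op j (\<lambda>X. g (config_of X)) X\<bar> \<le> real (card (I j)) * (2 * B)" for j
    unfolding left_op_def I_def[symmetric]
  proof (rule order.trans[OF sum_abs sum_bounded_above])
    fix z assume z: "z \<in> I j"
    have "j = 0 \<or> z < X (j - 1)"
      using z particle_seqs_less[OF X, of "j - 1" j] by (cases "j = 0") (auto simp: I_def)
    then have "X(j := z) \<in> particle_seqs" using z by (intro particle_seqs_upd[OF X]) (auto simp: I_def)
    then have "\<bar>g (config_of (X(j := z)))\<bar> \<le> B" "\<bar>g (config_of X)\<bar> \<le> B"
      using X by (auto intro!: g simp: configs_eq)
    then show "\<bar>g (config_of (X(j := z))) - g (config_of X)\<bar> \<le> 2 * B" by linarith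
  qed
  then have "\<bar>hammersley_gen g \<eta>\<bar> \<le> (\<Sum>j<n. real (Suc j) * (real (card (I j)) * (2 * B)))"
    unfolding \<eta> hammersley_gen_config_of[OF X n order.refl]
    by (intro order.trans[OF sum_abs] sum_mono) (simp add: abs_mult mult_left_mono)
  also have "\<dots> = 2 * B * real (card A)"
  proof -
    have "card A = (\<Sum>j<n. Suc j * card (I j))"
      by (simp add: A_def I_def card_cartesian_product)
    then show ?thesis by (simp only: sum_distrib_left of_nat_sum of_nat_mult mult_ac)
  qed
  also have "card A \<le> area \<eta>"
    unfolding area_def
  proof (rule card_inj_on_le[of "\<lambda>(j, i, z). (z, X i)"])
    have gap: "j = j'" if "z \<in> I j" "z \<in> I j'" for z j j'
    proof (rule ccontr)
      assume "j \<noteq> j'"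
      then consider "Suc j \<le> j'" | "Suc j' \<le> j" by linarith
      then show False
        using that particle_seqs_le[OF X, of "Suc j" j'] particle_seqs_le[OF X, of "Suc j'" j] by cases (auto simp: I_def)
    qed
    then show "inj_on (\<lambda>(j, i, z). (z, X i)) A"
    proof (intro inj_onI)
      fix p q assume h: "p \<in> A" "q \<in> A" "(\<lambda>(j, i, z). (z, X i)) p = (\<lambda>(j, i, z). (z, X i)) q"
      obtain j i z j' i' z' where pq: "p = (j, i, z)" "q = (j', i', z')" by (metis prod_cases3)
      then have "z = z'" "i = i'" using h(3) injD[OF particle_seqs_inj[OF X], of i i'] by auto
      then show "p = q" using h(1,2) gap[of z j j'] by (simp add: pq A_def)
    qed
    show "(\<lambda>(j, i, z). (z, X i)) ` A \<subseteq> inversions \<eta>"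
    proof clarsimp
      fix j i z assume "(j, i, z) \<in> A"
      then have z: "z \<in> I j" and ij: "i \<le> j" by (auto simp: A_def)
      have "j = 0 \<or> z < X (j - 1)"
        using z particle_seqs_less[OF X, of "j - 1" j] by (cases "j = 0") (auto simp: I_def)
      then have "z \<notin> range X" using z by (intro particle_seqs_not_range[OF X, of j]) (auto simp: I_def)
      moreover have "z < X i" using z particle_seqs_le[OF X ij] by (auto simp: I_def)
      ultimately show "(z, X i) \<in> inversions \<eta>" by (auto simp: inversions_def \<eta> config_of_def)
    qed
    show "finite (inversions \<eta>)" using N by (rule finite_inversions)
  qed
  finally show ?thesis using B by (simp add: mult_left_mono)
qed

text \<open>A jump raises \<open>1 + area\<close> by one and so at most doubles it, which costs
  \<open>2 ^ k\<close>. The difference of two values costs another factor 2, and the number of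
  jumps, at most \<open>1 + area\<close>, raises the exponent by one.\<close>

lemma tasep_gen_bound:
  assumes g: "\<And>\<zeta>. \<zeta> \<in> configs \<Longrightarrow> \<bar>g \<zeta>\<bar> \<le> C * (1 + real (area \<zeta>)) ^ k" and \<eta>: "\<eta> \<in> configs"
  shows "\<bar>tasep_gen g \<eta>\<bar> \<le> 2 ^ Suc k * C * (1 + real (area \<eta>)) ^ Suc k"
proof -
  obtain N where N: "agrees_outside N \<eta>" using \<eta> by (rule configs_agrees_outside)
  define W where "W = 1 + real (area \<eta>)"
  have W: "W \<ge> 1" by (simp add: W_def)
  have "0 \<le> C * W ^ k" using order.trans[OF abs_ge_zero g[OF \<eta>]] by (simp add: W_def)
  moreover have "0 < W ^ k" using W by simp
  ultimately have C: "0 \<le> C" by (simp add: zero_le_mult_iff del: zero_less_power_eq)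
  have "\<bar>tasep_gen g \<eta>\<bar> \<le> real (card (jumps \<eta>)) * (2 ^ Suc k * C * W ^ k)"
    unfolding tasep_gen_jumps[OF finite_jumps[OF N]]
  proof (rule order.trans[OF sum_abs sum_bounded_above])
    fix x assume x: "x \<in> jumps \<eta>"
    have "1 + real (area (move \<eta> x (x + 1))) = 1 + W"
      using area_move[OF N x] by (simp add: W_def)
    then have "\<bar>g (move \<eta> x (x + 1))\<bar> \<le> C * (1 + W) ^ k"
      using g[OF configs_move[OF \<eta> x]] by simp
    also have "\<dots> \<le> C * (2 * W) ^ k" using W C by (intro mult_left_mono power_mono) auto
    finally have "\<bar>g (move \<eta> x (x + 1))\<bar> \<le> 2 ^ k * C * W ^ k" by (simp add: power_mult_distrib mult_ac)
    moreover have "\<bar>g \<eta>\<bar> \<le> C * W ^ k" using g[OF \<eta>] by (simp add: W_def)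
    moreover have "C * W ^ k \<le> 2 ^ k * (C * W ^ k)"
      using C W by (intro mult_right_mono[of 1 _ "C * W ^ k", simplified]) auto
    ultimately show "\<bar>g (move \<eta> x (x + 1)) - g \<eta>\<bar> \<le> 2 ^ Suc k * C * W ^ k" by (simp add: mult.assoc)
  qed
  also have "\<dots> \<le> W * (2 ^ Suc k * C * W ^ k)"
    using card_jumps_le[OF N] C W by (intro mult_right_mono) (auto simp: W_def)
  finally show ?thesis by (simp add: W_def mult_ac)
qed

section \<open>Truncation to a finite window\<close>

lemma area_trunc_le:
  assumes "agrees_outside M \<eta>" shows "area (trunc N \<eta>) \<le> area \<eta>"
  unfolding area_def using finite_inversions[OF assms]
  by (rule card_mono) (auto simp: inversions_def trunc_def split: if_splits)

text \<open>Inside the window the jump commutes with truncation. A jump across an end changes one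
  site of the truncation: it fills \<open>- int N\<close>, which has no hole to its left, or empties
  \<open>int N\<close>, which has no particle to its right. Neither creates an inversion.\<close>

lemma area_trunc_move:
  assumes x: "x \<in> jumps \<eta>"
  shows "area (trunc N (move \<eta> x (x + 1))) \<le> area (trunc N \<eta>) + of_bool (- int N \<le> x \<and> x < int N)"
proof (cases "- int N \<le> x \<and> x < int N")
  case True
  have "trunc N (move \<eta> x (x + 1)) = move (trunc N \<eta>) x (x + 1)"
    using True by (auto simp: trunc_def move_def fun_eq_iff)
  moreover have "x \<in> jumps (trunc N \<eta>)" using True x by (auto simp: trunc_def jumps_def)
  ultimately show ?thesis using True area_move[OF agrees_outside_trunc, of x N \<eta>] by simp
next
  case False
  have "inversions (trunc N (move \<eta> x (x + 1))) \<subseteq> inversions (trunc N \<eta>)"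
  proof -
    consider "x < - int N - 1 \<or> x > int N" | "x = - int N - 1" | "x = int N" using False by linarith
    then show ?thesis
    proof cases
      case 1
      then have "trunc N (move \<eta> x (x + 1)) = trunc N \<eta>" by (auto simp: trunc_def move_def fun_eq_iff)
      then show ?thesis by simp
    next
      case 2
      then have "trunc N (move \<eta> x (x + 1)) = (trunc N \<eta>)(- int N := True)"
        by (auto simp: trunc_def move_def fun_eq_iff)
      moreover have "trunc N \<eta> a" if "a < - int N" for a
        using that by (simp add: trunc_def)
      ultimately show ?thesis unfolding inversions_def by (auto split: if_splits)
    next
      case 3
      then have "trunc N (move \<eta> x (x + 1)) = (trunc N \<eta>)(int N := False)"
        by (auto simp: trunc_def move_def fun_eq_iff)
      moreover have "\<not> trunc N \<eta> b" if "int N < b" for b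
        using that by (simp add: trunc_def)
      ultimately show ?thesis unfolding inversions_def by (auto split: if_splits)
    qed
  qed
  then show ?thesis
    unfolding area_def using finite_inversions[OF agrees_outside_trunc, of N \<eta>]
    by (simp add: card_mono trans_le_add1)
qed

text \<open>The bound involves only the truncated area, because a jump outside the window cannot
  increase it.\<close>

lemma trunc_cube_drift:
  assumes \<eta>: "\<eta> \<in> configs"
  shows "tasep_gen (\<lambda>\<zeta>. (1 + real (area (trunc N \<zeta>))) ^ 3) \<eta> \<le> 7 * (1 + real (area (trunc N \<eta>))) ^ 3"
proof -
  obtain M where M: "agrees_outside M \<eta>" using \<eta> by (rule configs_agrees_outside)
  have fin: "finite (jumps \<eta>)" using M by (rule finite_jumps)
  define W where "W = 1 + real (area (trunc N \<eta>))"
  \<comment> \<open>\<open>d\<close> is the growth of the cube when the truncated area rises by one.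
    It equals \<open>3 W^2 + 3 W + 1\<close>, and \<open>W \<ge> 1\<close> bounds this by
    \<open>7 W^2\<close>, which is the origin of the constant 7.\<close>
  define d where "d = (1 + W) ^ 3 - W ^ 3"
  have W: "W \<ge> 1" by (simp add: W_def)
  have W2: "W \<le> W\<^sup>2" using W self_le_power[of W 2] by simp
  have d: "d = 3 * W\<^sup>2 + 3 * W + 1" by (simp add: d_def power2_eq_square power3_eq_cube algebra_simps)
  then have d7: "0 \<le> d" "d \<le> 7 * W\<^sup>2" using W W2 by auto
  define A where "A = jumps \<eta> \<inter> {- int N..<int N}"
  have "tasep_gen (\<lambda>\<zeta>. (1 + real (area (trunc N \<zeta>))) ^ 3) \<eta>
      \<le> (\<Sum>x\<in>jumps \<eta>. if x \<in> A then d else 0)"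
    unfolding tasep_gen_jumps[OF fin]
  proof (rule sum_mono)
    fix x assume x: "x \<in> jumps \<eta>"
    have "1 + real (area (trunc N (move \<eta> x (x + 1)))) \<le> W + of_bool (x \<in> A)"
      using area_trunc_move[OF x, of N] x by (auto simp: W_def A_def split: if_splits)
    then have "(1 + real (area (trunc N (move \<eta> x (x + 1))))) ^ 3 \<le> (W + of_bool (x \<in> A)) ^ 3"
      by (intro power_mono) auto
    then show "(1 + real (area (trunc N (move \<eta> x (x + 1))))) ^ 3
        - (1 + real (area (trunc N \<eta>))) ^ 3 \<le> (if x \<in> A then d else 0)"
      unfolding W_def[symmetric] d_def by (auto simp: add.commute)
  qed
  also have "\<dots> = real (card A) * d"
  proof -
    have "jumps \<eta> \<inter> {x. x \<in> A} = A" by (auto simp: A_def)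
    then show ?thesis using fin by (simp add: sum.If_cases)
  qed
  also have "\<dots> \<le> W * d"
  proof (rule mult_right_mono)
    have "A \<subseteq> jumps (trunc N \<eta>)" by (auto simp: A_def jumps_def trunc_def)
    then have "card A \<le> card (jumps (trunc N \<eta>))"
      by (intro card_mono finite_jumps[OF agrees_outside_trunc])
    then show "real (card A) \<le> W" using card_jumps_le[OF agrees_outside_trunc, of N \<eta>] by (simp add: W_def)
  qed (rule d7)
  also have "\<dots> \<le> W * (7 * W\<^sup>2)" using d7 W by (intro mult_left_mono) auto
  finally show ?thesis by (simp add: W_def power2_eq_square power3_eq_cube mult_ac)
qed

section \<open>Cylinder functions and pointwise limits\<close>

lemma cylinder_trunc: "cylinder (\<lambda>\<eta>. F (trunc N \<eta>))"
  unfolding cylinder_def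
proof (intro exI[of _ "{- int N..int N}"] conjI allI impI)
  fix \<eta> \<zeta> :: config assume "\<forall>x\<in>{- int N..int N}. \<eta> x = \<zeta> x"
  then have "trunc N \<eta> = trunc N \<zeta>" by (auto simp: trunc_def)
  then show "F (trunc N \<eta>) = F (trunc N \<zeta>)" by simp
qed simp

lemma cylinder_bounded:
  assumes "cylinder f"
  obtains B where "\<And>\<eta>. \<bar>f \<eta>\<bar> \<le> B"
proof -
  obtain S where S: "finite S" "\<And>\<eta> \<zeta>. (\<forall>x\<in>S. \<eta> x = \<zeta> x) \<Longrightarrow> f \<eta> = f \<zeta>"
    using assms by (auto simp: cylinder_def)
  have "range f \<subseteq> (\<lambda>A. f (\<lambda>x. x \<in> A)) ` Pow S"
  proof
    fix y assume "y \<in> range f"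
    then obtain \<eta> where "y = f \<eta>" by blast
    also have "f \<eta> = f (\<lambda>x. x \<in> {x\<in>S. \<eta> x})" by (rule S) auto
    finally show "y \<in> (\<lambda>A. f (\<lambda>x. x \<in> A)) ` Pow S" by blast
  qed
  then have "finite (range f)" by (rule finite_subset) (simp add: S(1))
  then have "bounded (range f)" by (rule finite_imp_bounded)
  then show ?thesis using that by (auto simp: bounded_iff)
qed

text \<open>A jump can change \<open>f\<close> only if \<open>x\<close> or \<open>x + 1\<close> lies
  in \<open>S\<close>. This reduces the sum to the finite set \<open>T\<close> at every
  configuration, also outside \<open>configs\<close>, as \<open>cylinder\<close> demands.\<close>

lemma cylinder_tasep_gen:
  assumes "cylinder f"
  shows "cylinder (tasep_gen f)"
proof -
  obtain S where S: "finite S" "\<And>\<eta> \<zeta>. (\<forall>x\<in>S. \<eta> x = \<zeta> x) \<Longrightarrow> f \<eta> = f \<zeta>"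
    using assms by (auto simp: cylinder_def)
  define T where "T = S \<union> (\<lambda>x. x - 1) ` S"
  have T: "finite T" using S(1) by (simp add: T_def)
  have eq: "tasep_gen f \<eta> = (\<Sum>x\<in>T. occ \<eta> x * (1 - occ \<eta> (x + 1)) * (f (move \<eta> x (x + 1)) - f \<eta>))" for \<eta>
  proof -
    have "tasep_gen f \<eta> = (\<Sum>\<^sub>\<infinity>x\<in>T. occ \<eta> x * (1 - occ \<eta> (x + 1)) * (f (move \<eta> x (x + 1)) - f \<eta>))"
      unfolding tasep_gen_def
    proof (rule infsum_cong_neutral)
      fix x assume x: "x \<in> UNIV - T"
      have "x \<notin> S" "x + 1 \<notin> S" using x by (force simp: T_def)+
      then have "f (move \<eta> x (x + 1)) = f \<eta>" by (intro S(2)) (auto simp: move_def)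
      then show "occ \<eta> x * (1 - occ \<eta> (x + 1)) * (f (move \<eta> x (x + 1)) - f \<eta>) = 0" by simp
    qed auto
    then show ?thesis using T by simp
  qed
  show ?thesis
    unfolding cylinder_def
  proof (intro exI[of _ "T \<union> (\<lambda>x. x + 1) ` T"] conjI allI impI)
    fix \<eta> \<zeta> :: config assume h: "\<forall>x\<in>T \<union> (\<lambda>x. x + 1) ` T. \<eta> x = \<zeta> x"
    have "f \<eta> = f \<zeta>" using h by (intro S(2)) (auto simp: T_def)
    moreover have "f (move \<eta> x (x + 1)) = f (move \<zeta> x (x + 1))" for x
      using h by (intro S(2)) (auto simp: T_def move_def)
    ultimately show "tasep_gen f \<eta> = tasep_gen f \<zeta>"
      unfolding eq using h by (intro sum.cong) auto
  qed (use T in auto)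
qed

lemma tasep_gen_tendsto:
  assumes "\<eta> \<in> configs" and lim: "\<And>\<zeta>. \<zeta> \<in> configs \<Longrightarrow> (\<lambda>n. g n \<zeta>) \<longlonglongrightarrow> h \<zeta>"
  shows "(\<lambda>n. tasep_gen (g n) \<eta>) \<longlonglongrightarrow> tasep_gen h \<eta>"
proof -
  obtain N where N: "agrees_outside N \<eta>" using assms(1) by (rule configs_agrees_outside)
  show ?thesis unfolding tasep_gen_jumps[OF finite_jumps[OF N]]
    by (intro tendsto_sum tendsto_diff lim configs_move assms(1))
qed

lemma hammersley_gen_tendsto:
  assumes "\<eta> \<in> configs" and lim: "\<And>\<zeta>. (\<lambda>n. g n \<zeta>) \<longlonglongrightarrow> h \<zeta>"
  shows "(\<lambda>n. hammersley_gen (g n) \<eta>) \<longlonglongrightarrow> hammersley_gen h \<eta>"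
proof -
  obtain X where X: "X \<in> particle_seqs" and \<eta>: "\<eta> = config_of X" using assms by (auto simp: configs_eq)
  obtain n where n: "packed n X" using X by (rule particle_seqs_packed)
  show ?thesis
    unfolding \<eta> hammersley_gen_config_of[OF X n order.refl] left_op_def
    by (intro tendsto_sum tendsto_mult tendsto_const tendsto_diff lim)
qed

lemma area_step: "area step = 0"
proof -
  have "inversions step = {}" by (auto simp: inversions_def step_def)
  then show ?thesis by (simp add: area_def)
qed

lemma trunc_step: "trunc N step = step"
  by (auto simp: trunc_def step_def fun_eq_iff)

lemma eventually_trunc_eq:
  assumes "\<eta> \<in> configs" shows "\<forall>\<^sub>F N in sequentially. trunc N \<eta> = \<eta>"
proof -
  obtain M where M: "agrees_outside M \<eta>" using assms by (rule configs_agrees_outside)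
  then have "trunc N \<eta> = \<eta>" if "N \<ge> M" for N
    using that agrees_outside_mono[OF M] by (intro trunc_eq) auto
  then show ?thesis by (auto simp: eventually_sequentially)
qed

text \<open>Serves the Gronwall argument in \<open>moment_trunc\<close> and the comparison with a
  majorant in \<open>defect_iterated_bound\<close>, where derivatives at the ends of the interval
  are one-sided.\<close>

lemma nondecreasing_of_derivative_within:
  fixes f f' :: "real \<Rightarrow> real"
  assumes "0 \<le> t"
    and der: "\<And>s. 0 \<le> s \<Longrightarrow> s \<le> t \<Longrightarrow> (f has_real_derivative f' s) (at s within {0..t})"
    and nonneg: "\<And>s. 0 \<le> s \<Longrightarrow> s \<le> t \<Longrightarrow> 0 \<le> f' s"
  shows "f 0 \<le> f t"
proof (rule DERIV_nonneg_imp_increasing_open[OF \<open>0 \<le> t\<close>])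
  fix s assume s: "0 < s" "s < t"
  then have "(f has_real_derivative f' s) (at s)"
    using der[of s] at_within_Icc_at[of 0 s t] by simp
  then show "\<exists>y. (f has_real_derivative y) (at s) \<and> 0 \<le> y" using nonneg s by force
next
  show "continuous_on {0..t} f"
    using der by (intro DERIV_continuous_on) auto
qed

section \<open>The forward equation\<close>

locale tasep =
  fixes P :: "real \<Rightarrow> config \<Rightarrow> config pmf"
  assumes P: "tasep_semigroup P"
begin

abbreviation mean :: "real \<Rightarrow> (config \<Rightarrow> real) \<Rightarrow> real" where
  "mean s h \<equiv> measure_pmf.expectation (P s step) h"

lemma set_P: "0 \<le> s \<Longrightarrow> \<eta> \<in> configs \<Longrightarrow> set_pmf (P s \<eta>) \<subseteq> configs"
  using P by (auto simp: tasep_semigroup_def markov_semigroup_def)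

lemma P_configs: "0 \<le> s \<Longrightarrow> \<eta> \<in> set_pmf (P s step) \<Longrightarrow> \<eta> \<in> configs"
  using set_P[of s step] step_in_configs by auto

lemma AE_configs: "0 \<le> s \<Longrightarrow> AE \<eta> in P s step. \<eta> \<in> configs"
  by (auto simp: AE_measure_pmf_iff P_configs)

lemma mean_cong: "0 \<le> s \<Longrightarrow> (\<And>\<eta>. \<eta> \<in> configs \<Longrightarrow> g \<eta> = h \<eta>) \<Longrightarrow> mean s g = mean s h"
  by (intro integral_cong_AE) (auto simp: AE_measure_pmf_iff P_configs)

lemma mean_0: "mean 0 h = h step"
proof -
  have "P 0 step = return_pmf step"
    using P step_in_configs by (auto simp: tasep_semigroup_def markov_semigroup_def)
  then show ?thesis by (simp add: integral_return)
qed

lemma mean_add: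
  fixes f :: "config \<Rightarrow> real" and B :: real
  assumes "0 \<le> s" "0 \<le> h" "\<And>\<eta>. \<bar>f \<eta>\<bar> \<le> B"
  shows "mean (s + h) f = mean s (\<lambda>\<eta>. measure_pmf.expectation (P h \<eta>) f)"
proof -
  have "P (s + h) step = bind_pmf (P s step) (P h)"
    using P step_in_configs assms by (auto simp: tasep_semigroup_def markov_semigroup_def)
  then have "mean (s + h) f = integral\<^sup>L (measure_pmf (P s step) \<bind> (\<lambda>x. measure_pmf (P h x))) f"
    by (simp add: measure_pmf_bind)
  also have "\<dots> = mean s (\<lambda>\<eta>. measure_pmf.expectation (P h \<eta>) f)"
    using measurable_measure_pmf[of "P h"] assms(3)
    by (intro integral_bind[where K = "count_space UNIV" and B = B and B' = 1])
      (auto simp: measure_pmf.emeasure_space_1[unfolded space_measure_pmf] intro: measure_pmf.finite_measure)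
  finally show ?thesis .
qed

lemma integrable_bounded:
  fixes f :: "config \<Rightarrow> real" and B :: real
  assumes "\<And>\<eta>. \<bar>f \<eta>\<bar> \<le> B" shows "integrable (measure_pmf p) f"
  using assms by (intro measure_pmf.integrable_const_bound[of _ B]) auto

lemma mean_abs_le:
  assumes "0 \<le> s" "\<And>\<eta>. \<eta> \<in> configs \<Longrightarrow> \<bar>f \<eta>\<bar> \<le> B" shows "\<bar>mean s f\<bar> \<le> B"
proof -
  have B: "0 \<le> B" using assms(2)[OF step_in_configs] by linarith
  have ae: "AE \<eta> in P s step. \<bar>f \<eta>\<bar> \<le> B" using assms by (auto simp: AE_measure_pmf_iff P_configs)
  then have "integrable (P s step) f" by (intro measure_pmf.integrable_const_bound[of _ B]) auto
  then have "mean s (\<lambda>\<eta>. \<bar>f \<eta>\<bar>) \<le> B" using ae by (intro measure_pmf.integral_le_const) auto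
  then show ?thesis using integral_abs_bound[of "P s step" f] by linarith
qed

text \<open>By the semigroup property the increment after time \<open>s\<close> is the mean of
  increments started afresh from \<open>configs\<close>, which the uniform limit at time 0 controls.
  Hence \<open>d\<close> does not depend on \<open>s\<close>; left derivatives rely on this, as
  there the starting time of the increment varies.\<close>

lemma increment:
  assumes f: "cylinder f" and e: "e > 0"
  obtains d where "d > 0"
    "\<And>s h. 0 \<le> s \<Longrightarrow> 0 < h \<Longrightarrow> h < d \<Longrightarrow> \<bar>mean (s + h) f - mean s f - h * mean s (tasep_gen f)\<bar> \<le> e * h"
proof -
  obtain B where B: "\<And>\<eta>. \<bar>f \<eta>\<bar> \<le> B" using f by (rule cylinder_bounded) blast
  obtain B' where B': "\<And>\<eta>. \<bar>tasep_gen f \<eta>\<bar> \<le> B'"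
    using cylinder_tasep_gen[OF f] by (rule cylinder_bounded) blast
  have "uniform_limit configs (\<lambda>h \<eta>. (measure_pmf.expectation (P h \<eta>) f - f \<eta>) / h) (tasep_gen f) (at_right 0)"
    using P f by (auto simp: tasep_semigroup_def)
  then have "\<forall>\<^sub>F h in at_right 0. \<forall>\<eta>\<in>configs.
      dist ((measure_pmf.expectation (P h \<eta>) f - f \<eta>) / h) (tasep_gen f \<eta>) < e"
    using e by (auto simp: uniform_limit_iff)
  then obtain d where d: "d > 0" and D: "\<And>h \<eta>. 0 < h \<Longrightarrow> h < d \<Longrightarrow> \<eta> \<in> configs \<Longrightarrow>
      \<bar>(measure_pmf.expectation (P h \<eta>) f - f \<eta>) / h - tasep_gen f \<eta>\<bar> < e"
    by (auto simp: eventually_at_right_field dist_real_def)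
  have "\<bar>mean (s + h) f - mean s f - h * mean s (tasep_gen f)\<bar> \<le> e * h" if s: "0 \<le> s" and h: "0 < h" "h < d" for s h
  proof -
    define E where "E \<eta> = measure_pmf.expectation (P h \<eta>) f" for \<eta>
    have "\<bar>E \<eta>\<bar> \<le> B" for \<eta>
    proof -
      have "integrable (P h \<eta>) f" using B by (rule integrable_bounded)
      then have "measure_pmf.expectation (P h \<eta>) (\<lambda>\<eta>. \<bar>f \<eta>\<bar>) \<le> B"
        using B by (intro measure_pmf.integral_le_const) auto
      then show ?thesis using integral_abs_bound[of "P h \<eta>" f] unfolding E_def by linarith
    qed
    note int = integrable_bounded[of E, OF this] integrable_bounded[of f, OF B]
      integrable_bounded[of "tasep_gen f", OF B']
    have "mean (s + h) f - mean s f - h * mean s (tasep_gen f) = mean s (\<lambda>\<eta>. E \<eta> - f \<eta> - h * tasep_gen f \<eta>)"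
    proof -
      have "mean (s + h) f = mean s E"
        unfolding E_def by (rule mean_add[OF s less_imp_le[OF h(1)] B])
      then show ?thesis using int by simp
    qed
    also have "\<bar>\<dots>\<bar> \<le> e * h"
    proof (rule mean_abs_le[OF s])
      fix \<eta> assume "\<eta> \<in> configs"
      then have "\<bar>(E \<eta> - f \<eta>) / h - tasep_gen f \<eta>\<bar> * h \<le> e * h"
        using D[OF h, of \<eta>] h by (intro mult_right_mono) (auto simp: E_def)
      also have "\<bar>(E \<eta> - f \<eta>) / h - tasep_gen f \<eta>\<bar> * h = \<bar>((E \<eta> - f \<eta>) / h - tasep_gen f \<eta>) * h\<bar>"
        using h by (simp add: abs_mult)
      also have "((E \<eta> - f \<eta>) / h - tasep_gen f \<eta>) * h = E \<eta> - f \<eta> - h * tasep_gen f \<eta>"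
        using h by (simp add: field_simps)
      finally show "\<bar>E \<eta> - f \<eta> - h * tasep_gen f \<eta>\<bar> \<le> e * h" .
    qed
    finally show ?thesis .
  qed
  then show ?thesis using d that by blast
qed

text \<open>The increment estimate with error 1 and the boundedness of \<open>tasep_gen f\<close>
  give a local Lipschitz bound. Applied to \<open>tasep_gen f\<close>, this makes the derivative of
  \<open>mean s f\<close> continuous.\<close>

lemma cylinder_continuous:
  assumes f: "cylinder f" and x: "0 \<le> x"
  shows "((\<lambda>s. mean s f) \<longlongrightarrow> mean x f) (at x within {0..})"
proof -
  obtain B where B: "\<And>\<eta>. \<bar>tasep_gen f \<eta>\<bar> \<le> B"
    using cylinder_tasep_gen[OF f] by (rule cylinder_bounded) blast
  have B0: "0 \<le> B" using B[of step] by linarith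
  obtain d where d: "d > 0" "\<And>s h. 0 \<le> s \<Longrightarrow> 0 < h \<Longrightarrow> h < d \<Longrightarrow>
      \<bar>mean (s + h) f - mean s f - h * mean s (tasep_gen f)\<bar> \<le> 1 * h"
    using increment[OF f, of 1] by auto
  have inc: "\<bar>mean (s + h) f - mean s f\<bar> \<le> (B + 1) * h" if "0 \<le> s" "0 < h" "h < d" for s h
  proof -
    have "\<bar>h * mean s (tasep_gen f)\<bar> \<le> h * B"
      using mean_abs_le[OF that(1) B] that by (simp add: abs_mult)
    then show ?thesis using d(2)[OF that] by (simp add: algebra_simps)
  qed
  have lip: "\<bar>mean y f - mean x f\<bar> \<le> (B + 1) * \<bar>y - x\<bar>" if "0 \<le> y" "\<bar>y - x\<bar> < d" for y
    using inc[of x "y - x"] inc[of y "x - y"] that x by (cases y x rule: linorder_cases) auto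
  have "((\<lambda>y. (B + 1) * \<bar>y - x\<bar>) \<longlongrightarrow> (B + 1) * \<bar>x - x\<bar>) (at x within {0..})"
    by (intro tendsto_intros)
  then have "((\<lambda>y. (B + 1) * \<bar>y - x\<bar>) \<longlongrightarrow> 0) (at x within {0..})" by simp
  moreover have "\<forall>\<^sub>F y in at x within {0..}. norm (mean y f - mean x f) \<le> (B + 1) * \<bar>y - x\<bar>"
    using lip d(1) by (auto simp: eventually_at dist_real_def intro!: exI[of _ d])
  ultimately have "((\<lambda>y. mean y f - mean x f) \<longlongrightarrow> 0) (at x within {0..})" by (rule Lim_null_comparison[rotated])
  then show ?thesis by (rule LIM_zero_cancel)
qed

lemma cylinder_derivative:
  assumes f: "cylinder f" and x: "0 \<le> x"
  shows "((\<lambda>s. mean s f) has_real_derivative mean x (tasep_gen f)) (at x within {0..})"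
  unfolding has_field_derivative_iff
proof (rule tendstoI)
  fix e :: real assume "e > 0"
  then have e: "e / 3 > 0" by simp
  obtain d where d: "d > 0" "\<And>s h. 0 \<le> s \<Longrightarrow> 0 < h \<Longrightarrow> h < d \<Longrightarrow>
      \<bar>mean (s + h) f - mean s f - h * mean s (tasep_gen f)\<bar> \<le> e / 3 * h"
    using increment[OF f e] by blast
  define \<psi> where "\<psi> s = mean s (tasep_gen f)" for s
  have "\<forall>\<^sub>F y in at x within {0..}. \<bar>\<psi> y - \<psi> x\<bar> < e / 3"
    using tendstoD[OF cylinder_continuous[OF cylinder_tasep_gen[OF f] x] e]
    by (simp add: \<psi>_def dist_real_def)
  moreover have "\<forall>\<^sub>F y in at x within {0..}. 0 \<le> y \<and> y \<noteq> x \<and> \<bar>y - x\<bar> < d"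
    using d(1) by (auto simp: eventually_at dist_real_def intro!: exI[of _ d])
  ultimately show "\<forall>\<^sub>F y in at x within {0..}. dist ((mean y f - mean x f) / (y - x)) (mean x (tasep_gen f)) < e"
  proof eventually_elim
    case (elim y)
    have quot: "\<bar>q / h - c\<bar> \<le> e / 3" if "\<bar>q - h * c\<bar> \<le> e / 3 * h" "h > 0" for q h c
    proof -
      have "q / h - c = (q - h * c) / h" using that(2) by (simp add: field_simps)
      then have "\<bar>q / h - c\<bar> = \<bar>q - h * c\<bar> / h" using that(2) by simp
      then show ?thesis using that by (simp add: pos_divide_le_eq)
    qed
    consider "y > x" | "y < x" using elim by linarith
    then show ?case
    proof cases
      case 1
      have "\<bar>(mean y f - mean x f) / (y - x) - \<psi> x\<bar> \<le> e / 3"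
        using d(2)[of x "y - x"] 1 elim x by (intro quot) (auto simp: \<psi>_def)
      then show ?thesis using \<open>e > 0\<close> by (simp add: dist_real_def \<psi>_def)
    next
      \<comment> \<open>From the left the increment starts at \<open>y\<close>, so the quotient is
        close to \<open>\<psi> y\<close> rather than \<open>\<psi> x\<close>; continuity of
        \<open>\<psi>\<close> closes the difference.\<close>
      case 2
      have "\<bar>(mean x f - mean y f) / (x - y) - \<psi> y\<bar> \<le> e / 3"
        using d(2)[of y "x - y"] 2 elim x by (intro quot) (auto simp: \<psi>_def)
      moreover have "(mean x f - mean y f) / (x - y) = (mean y f - mean x f) / (y - x)"
        by (metis minus_diff_eq minus_divide_divide)
      ultimately have "\<bar>(mean y f - mean x f) / (y - x) - \<psi> x\<bar> < e"
        using elim \<open>e > 0\<close> by linarith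
      then show ?thesis by (simp add: dist_real_def \<psi>_def)
    qed
  qed
qed

lemma cylinder_has_integral:
  assumes f: "cylinder f" and t: "0 \<le> t"
  shows "((\<lambda>s. mean s (tasep_gen f)) has_integral (mean t f - f step)) {0..t}"
proof -
  have "((\<lambda>s. mean s f) has_vector_derivative mean x (tasep_gen f)) (at x within {0..t})" if "x \<in> {0..t}" for x
    using cylinder_derivative[OF f, of x] that
    by (auto simp: has_real_derivative_iff_has_vector_derivative intro: has_vector_derivative_within_subset)
  from fundamental_theorem_of_calculus[OF t this] show ?thesis by (simp add: mean_0)
qed

section \<open>The third moment of the area\<close>

lemma moment_trunc:
  assumes t: "0 \<le> t"
  shows "mean t (\<lambda>\<eta>. (1 + real (area (trunc N \<eta>))) ^ 3) \<le> exp (7 * t)"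
proof -
  define u where "u = (\<lambda>\<eta>. (1 + real (area (trunc N \<eta>))) ^ 3)"
  have cyl: "cylinder u" unfolding u_def by (rule cylinder_trunc)
  obtain B where B: "\<And>\<eta>. \<bar>u \<eta>\<bar> \<le> B" using cyl by (rule cylinder_bounded) blast
  obtain B' where B': "\<And>\<eta>. \<bar>tasep_gen u \<eta>\<bar> \<le> B'"
    using cylinder_tasep_gen[OF cyl] by (rule cylinder_bounded) blast
  have le: "mean s (tasep_gen u) \<le> 7 * mean s u" if "0 \<le> s" for s
  proof -
    have "mean s (tasep_gen u) \<le> mean s (\<lambda>\<eta>. 7 * u \<eta>)"
    proof (rule integral_mono_AE)
      show "AE \<eta> in P s step. tasep_gen u \<eta> \<le> 7 * u \<eta>"
        using AE_configs[OF that] by eventually_elim (simp add: u_def trunc_cube_drift)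
    qed (auto intro!: integrable_bounded B B')
    then show ?thesis by simp
  qed
  \<comment> \<open>Gronwall: the drift bound makes \<open>exp (- 7 * s) * mean s u\<close>
    nonincreasing, so its negative is nondecreasing. The initial value is 1 because the step
    configuration has area 0.\<close>
  define F where "F s = - exp (- 7 * s) * mean s u" for s
  have "F 0 \<le> F t"
  proof (rule nondecreasing_of_derivative_within[OF t])
    fix s assume s: "0 \<le> s" "s \<le> t"
    have "((\<lambda>s. mean s u) has_real_derivative mean s (tasep_gen u)) (at s within {0..t})"
      using cylinder_derivative[OF cyl s(1)] by (rule DERIV_subset) auto
    then show "(F has_real_derivative (exp (- 7 * s) * (7 * mean s u - mean s (tasep_gen u)))) (at s within {0..t})"
      unfolding F_def by (auto intro!: derivative_eq_intros simp: algebra_simps)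
    show "0 \<le> exp (- 7 * s) * (7 * mean s u - mean s (tasep_gen u))" using le[OF s(1)] by simp
  qed
  then have "exp (- 7 * t) * mean t u \<le> 1"
    by (simp add: F_def mean_0 u_def trunc_step area_step)
  then show ?thesis by (simp add: u_def exp_minus field_simps)
qed

text \<open>Fatou along the truncations: on \<open>configs\<close> they are eventually the identity,
  and the bound of \<open>moment_trunc\<close> is uniform in \<open>N\<close>. The nonnegative
  integral is used because integrability is only derived from this bound.\<close>

lemma nn_moment:
  assumes t: "0 \<le> t"
  shows "(\<integral>\<^sup>+\<eta>. ennreal ((1 + real (area \<eta>)) ^ 3) \<partial>P t step) \<le> ennreal (exp (7 * t))"
proof -
  define u where "u N = (\<lambda>\<eta>. (1 + real (area (trunc N \<eta>))) ^ 3)" for N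
  have cyl: "cylinder (u N)" for N unfolding u_def by (rule cylinder_trunc)
  have "(\<integral>\<^sup>+\<eta>. ennreal ((1 + real (area \<eta>)) ^ 3) \<partial>P t step)
      = (\<integral>\<^sup>+\<eta>. liminf (\<lambda>N. ennreal (u N \<eta>)) \<partial>P t step)"
  proof (rule nn_integral_cong_AE)
    show "AE \<eta> in P t step. ennreal ((1 + real (area \<eta>)) ^ 3) = liminf (\<lambda>N. ennreal (u N \<eta>))"
      using AE_configs[OF t]
    proof eventually_elim
      case (elim \<eta>)
      have "\<forall>\<^sub>F N in sequentially. ennreal (u N \<eta>) = ennreal ((1 + real (area \<eta>)) ^ 3)"
        using eventually_trunc_eq[OF elim] by eventually_elim (simp add: u_def)
      then have "liminf (\<lambda>N. ennreal (u N \<eta>)) = liminf (\<lambda>N. ennreal ((1 + real (area \<eta>)) ^ 3))"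
        by (rule Liminf_eq)
      then show ?case by (simp add: Liminf_const)
    qed
  qed
  also have "\<dots> \<le> liminf (\<lambda>N. \<integral>\<^sup>+\<eta>. ennreal (u N \<eta>) \<partial>P t step)"
    by (rule nn_integral_liminf) auto
  also have "\<dots> \<le> liminf (\<lambda>N::nat. ennreal (exp (7 * t)))"
  proof (rule Liminf_mono, rule always_eventually, rule allI)
    fix N
    obtain B where B: "\<And>\<eta>. \<bar>u N \<eta>\<bar> \<le> B" using cyl by (rule cylinder_bounded) blast
    have "(\<integral>\<^sup>+\<eta>. ennreal (u N \<eta>) \<partial>P t step) = ennreal (mean t (u N))"
    proof (rule nn_integral_eq_integral)
      show "integrable (P t step) (u N)" using B by (rule integrable_bounded)
    qed (simp add: u_def)
    then show "(\<integral>\<^sup>+\<eta>. ennreal (u N \<eta>) \<partial>P t step) \<le> ennreal (exp (7 * t))"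
      using moment_trunc[OF t, of N] by (simp add: u_def ennreal_leI)
  qed
  finally show ?thesis by (simp add: Liminf_const)
qed

lemma moment:
  assumes t: "0 \<le> t"
  shows "integrable (P t step) (\<lambda>\<eta>. (1 + real (area \<eta>)) ^ 3)"
    and "mean t (\<lambda>\<eta>. (1 + real (area \<eta>)) ^ 3) \<le> exp (7 * t)"
proof -
  show int: "integrable (P t step) (\<lambda>\<eta>. (1 + real (area \<eta>)) ^ 3)"
    using nn_moment[OF t] by (intro integrableI_bounded) (auto simp: le_less_trans)
  have "ennreal (mean t (\<lambda>\<eta>. (1 + real (area \<eta>)) ^ 3)) \<le> ennreal (exp (7 * t))"
    using nn_moment[OF t] nn_integral_eq_integral[OF int] by simp
  then show "mean t (\<lambda>\<eta>. (1 + real (area \<eta>)) ^ 3) \<le> exp (7 * t)" by (simp add: ennreal_le_iff)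
qed

section \<open>Extension of the forward equation to functions of polynomial growth\<close>

lemma area_power_mono:
  assumes "0 \<le> C" "k \<le> 3"
  shows "C * (1 + real (area \<eta>)) ^ k \<le> C * (1 + real (area \<eta>)) ^ 3"
  using assms by (intro mult_left_mono power_increasing) auto

lemma
  assumes t: "0 \<le> t" and k: "k \<le> 3"
    and h: "\<And>\<eta>. \<eta> \<in> configs \<Longrightarrow> \<bar>h \<eta>\<bar> \<le> C * (1 + real (area \<eta>)) ^ k"
  shows integrable_growth: "integrable (P t step) h"
    and mean_growth: "\<bar>mean t h\<bar> \<le> C * exp (7 * t)"
proof -
  have C: "0 \<le> C" using order.trans[OF abs_ge_zero h[OF step_in_configs]] by (simp add: area_step)
  define w where "w = (\<lambda>\<eta>. C * (1 + real (area \<eta>)) ^ 3)"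
  have int: "integrable (P t step) w" unfolding w_def using moment[OF t] by simp
  have ae: "AE \<eta> in P t step. \<bar>h \<eta>\<bar> \<le> w \<eta>"
    using AE_configs[OF t] by eventually_elim (use h area_power_mono[OF C k] in \<open>auto simp: w_def intro: order.trans\<close>)
  show i: "integrable (P t step) h"
    using ae by (intro Bochner_Integration.integrable_bound[OF int]) (auto elim!: eventually_mono)
  have "\<bar>mean t h\<bar> \<le> mean t (\<lambda>\<eta>. \<bar>h \<eta>\<bar>)" by (rule integral_abs_bound)
  also have "\<dots> \<le> mean t w" using i int ae by (intro integral_mono_AE) auto
  also have "\<dots> \<le> C * exp (7 * t)" using moment(2)[OF t] C by (simp add: w_def mult_left_mono)
  finally show "\<bar>mean t h\<bar> \<le> C * exp (7 * t)" .
qed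

lemma mean_tendsto:
  assumes s: "0 \<le> s"
    and bound: "\<And>N \<eta>. \<eta> \<in> configs \<Longrightarrow> \<bar>g N \<eta>\<bar> \<le> C * (1 + real (area \<eta>)) ^ 3"
    and lim: "\<And>\<eta>. \<eta> \<in> configs \<Longrightarrow> (\<lambda>N. g N \<eta>) \<longlonglongrightarrow> h \<eta>"
  shows "(\<lambda>N. mean s (g N)) \<longlonglongrightarrow> mean s h"
proof (rule integral_dominated_convergence)
  show "integrable (P s step) (\<lambda>\<eta>. C * (1 + real (area \<eta>)) ^ 3)" using moment[OF s] by simp
  show "AE \<eta> in P s step. (\<lambda>N. g N \<eta>) \<longlonglongrightarrow> h \<eta>"
    using AE_configs[OF s] by eventually_elim (rule lim)
  show "AE \<eta> in P s step. norm (g N \<eta>) \<le> C * (1 + real (area \<eta>)) ^ 3" for N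
    using AE_configs[OF s] by eventually_elim (simp add: bound)
qed simp_all

text \<open>Cylinder functions \<open>g N\<close> approximate \<open>h\<close>, and dominated
  convergence is applied to the means and then to the time integral. \<open>tasep_gen\<close> raises
  the growth by one power, so quadratic growth of \<open>h\<close> is what the third moment can
  dominate.\<close>

lemma forward_has_integral:
  assumes t: "0 \<le> t" and h: "\<And>\<eta>. \<eta> \<in> configs \<Longrightarrow> \<bar>h \<eta>\<bar> \<le> C * (1 + real (area \<eta>)) ^ 2"
  shows "((\<lambda>s. mean s (tasep_gen h)) has_integral (mean t h - h step)) {0..t}"
proof -
  have C: "0 \<le> C" using order.trans[OF abs_ge_zero h[OF step_in_configs]] by (simp add: area_step)
  \<comment> \<open>Nothing bounds \<open>h\<close> outside \<open>configs\<close>, where a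
    truncated configuration may lie. The value 0 there keeps the growth bound and does not affect
    the limit.\<close>
  define g where "g N = (\<lambda>\<eta>. if trunc N \<eta> \<in> configs then h (trunc N \<eta>) else 0)" for N
  have cyl: "cylinder (g N)" for N
    using cylinder_trunc[of "\<lambda>\<zeta>. if \<zeta> \<in> configs then h \<zeta> else 0" N] by (simp add: g_def)
  have bound: "\<bar>g N \<eta>\<bar> \<le> C * (1 + real (area \<eta>)) ^ 2" if \<eta>: "\<eta> \<in> configs" for N \<eta>
  proof (cases "trunc N \<eta> \<in> configs")
    case True
    obtain M where M: "agrees_outside M \<eta>" using \<eta> by (rule configs_agrees_outside)
    have "\<bar>g N \<eta>\<bar> \<le> C * (1 + real (area (trunc N \<eta>))) ^ 2" using h[OF True] True by (simp add: g_def)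
    also have "\<dots> \<le> C * (1 + real (area \<eta>)) ^ 2"
      using area_trunc_le[OF M, of N] C by (intro mult_left_mono power_mono) auto
    finally show ?thesis .
  qed (use C in \<open>simp add: g_def\<close>)
  have lim: "(\<lambda>N. g N \<eta>) \<longlonglongrightarrow> h \<eta>" if "\<eta> \<in> configs" for \<eta>
  proof (rule tendsto_eventually)
    show "\<forall>\<^sub>F N in sequentially. g N \<eta> = h \<eta>"
      using eventually_trunc_eq[OF that] by eventually_elim (simp add: g_def that)
  qed
  have Tbound: "\<bar>tasep_gen (g N) \<eta>\<bar> \<le> 8 * C * (1 + real (area \<eta>)) ^ 3" if "\<eta> \<in> configs" for N \<eta>
    using tasep_gen_bound[of "g N" C 2 \<eta>, OF bound that] by (simp add: eval_nat_numeral)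
  have Tlim: "(\<lambda>N. mean s (tasep_gen (g N))) \<longlonglongrightarrow> mean s (tasep_gen h)" if "0 \<le> s" for s
    using that Tbound tasep_gen_tendsto[of _ g h, OF _ lim] by (rule mean_tendsto)
  have elim: "(\<lambda>N. mean s (g N)) \<longlonglongrightarrow> mean s h" if "0 \<le> s" for s
  proof (rule mean_tendsto[OF that])
    show "\<bar>g N \<eta>\<bar> \<le> C * (1 + real (area \<eta>)) ^ 3" if "\<eta> \<in> configs" for N \<eta>
      using bound[OF that, of N] area_power_mono[OF C, of 2 \<eta>] by simp
  qed (rule lim)
  have I: "((\<lambda>s. mean s (tasep_gen (g N))) has_integral (mean t (g N) - g N step)) {0..t}" for N
    using cyl t by (rule cylinder_has_integral)
  have le: "norm (mean s (tasep_gen (g N))) \<le> 8 * C * exp (7 * t)" if "s \<in> {0..t}" for s N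
  proof -
    have "\<bar>mean s (tasep_gen (g N))\<bar> \<le> 8 * C * exp (7 * s)"
      using that Tbound by (intro mean_growth[of _ 3]) auto
    also have "\<dots> \<le> 8 * C * exp (7 * t)" using that C by (intro mult_left_mono) auto
    finally show ?thesis by simp
  qed
  \<comment> \<open>Now the limit is taken in the time integral; the moment bound is monotone in
    time, so its value at \<open>t\<close> is a constant majorant.\<close>
  note D = dominated_convergence[of "\<lambda>N s. mean s (tasep_gen (g N))" "{0..t}" "\<lambda>s. 8 * C * exp (7 * t)"
      "\<lambda>s. mean s (tasep_gen h)", OF has_integral_integrable[OF I] integrable_const_ivl le]
  have int: "(\<lambda>s. mean s (tasep_gen h)) integrable_on {0..t}"
    by (rule D(1)) (auto intro: Tlim)
  have "(\<lambda>N. integral {0..t} (\<lambda>s. mean s (tasep_gen (g N)))) \<longlonglongrightarrow> integral {0..t} (\<lambda>s. mean s (tasep_gen h))"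
    by (rule D(2)) (auto intro: Tlim)
  moreover have "(\<lambda>N. integral {0..t} (\<lambda>s. mean s (tasep_gen (g N)))) \<longlonglongrightarrow> mean t h - h step"
    unfolding integral_unique[OF I] by (intro tendsto_diff elim[OF t] lim step_in_configs)
  ultimately have "integral {0..t} (\<lambda>s. mean s (tasep_gen h)) = mean t h - h step"
    by (rule LIMSEQ_unique)
  with int show ?thesis by (simp add: has_integral_iff)
qed

lemma forward_continuous:
  assumes h: "\<And>\<eta>. \<eta> \<in> configs \<Longrightarrow> \<bar>h \<eta>\<bar> \<le> C * (1 + real (area \<eta>)) ^ 2"
  shows "continuous_on {0..t} (\<lambda>s. mean s h)"
proof (cases "0 \<le> t")
  case True
  have "continuous_on {0..t} (\<lambda>s. h step + integral {0..s} (\<lambda>s. mean s (tasep_gen h)))"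
    using forward_has_integral[OF True h]
    by (intro continuous_intros indefinite_integral_continuous_1) (auto simp: has_integral_iff)
  moreover have "h step + integral {0..s} (\<lambda>s. mean s (tasep_gen h)) = mean s h" if "s \<in> {0..t}" for s
    using integral_unique[OF forward_has_integral[of s h C]] that h by simp
  ultimately show ?thesis by (simp cong: continuous_on_cong_simp)
qed simp

text \<open>Differentiating the integral form requires continuity of
  \<open>mean s (tasep_gen h)\<close>, hence at most quadratic growth of \<open>tasep_gen h\<close>;
  this is why \<open>h\<close> itself has linear growth here.\<close>

lemma forward_derivative:
  assumes h: "\<And>\<eta>. \<eta> \<in> configs \<Longrightarrow> \<bar>h \<eta>\<bar> \<le> C * (1 + real (area \<eta>))" and s: "0 \<le> s" "s \<le> t"
  shows "((\<lambda>s. mean s h) has_real_derivative mean s (tasep_gen h)) (at s within {0..t})"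
proof -
  have C: "0 \<le> C" using order.trans[OF abs_ge_zero h[OF step_in_configs]] by (simp add: area_step)
  have h2: "\<bar>h \<eta>\<bar> \<le> C * (1 + real (area \<eta>)) ^ 2" if "\<eta> \<in> configs" for \<eta>
  proof -
    have "C * (1 + real (area \<eta>)) \<le> C * (1 + real (area \<eta>)) ^ 2"
      using C self_le_power[of "1 + real (area \<eta>)" 2] by (intro mult_left_mono) auto
    then show ?thesis using h[OF that] by linarith
  qed
  have Th: "\<bar>tasep_gen h \<eta>\<bar> \<le> 4 * C * (1 + real (area \<eta>)) ^ 2" if "\<eta> \<in> configs" for \<eta>
    using tasep_gen_bound[of h C 1 \<eta>] h that by (simp add: eval_nat_numeral)
  have "((\<lambda>s. integral {0..s} (\<lambda>s. mean s (tasep_gen h))) has_real_derivative mean s (tasep_gen h)) (at s within {0..t})"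
    using forward_continuous[of "tasep_gen h" "4 * C" t, OF Th] s by (intro integral_has_real_derivative) auto
  from DERIV_add[OF DERIV_const[of "h step"] this]
  have "((\<lambda>s. h step + integral {0..s} (\<lambda>s. mean s (tasep_gen h))) has_real_derivative mean s (tasep_gen h))
      (at s within {0..t})" by simp
  moreover have "h step + integral {0..u} (\<lambda>s. mean s (tasep_gen h)) = mean u h" if "u \<in> {0..t}" for u
    using integral_unique[OF forward_has_integral[of u h C]] that h2 by simp
  ultimately show ?thesis
    using s by (auto intro: has_field_derivative_transform_within[of _ _ _ _ 1])
qed

section \<open>Uniqueness\<close>

text \<open>For bounded \<open>g\<close> this is the mean of \<open>full_gen s g\<close> at time
  \<open>s\<close>, so invariance means that it vanishes.\<close>

definition defect :: "real \<Rightarrow> (config \<Rightarrow> real) \<Rightarrow> real" where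
  "defect s g = mean s (hammersley_gen g) + s * mean s (tasep_gen g)"

lemma hammersley_gen_growth:
  assumes g: "\<And>\<zeta>. \<zeta> \<in> configs \<Longrightarrow> \<bar>g \<zeta>\<bar> \<le> B" and \<eta>: "\<eta> \<in> configs"
  shows "\<bar>hammersley_gen g \<eta>\<bar> \<le> 2 * B * (1 + real (area \<eta>))"
proof -
  have "0 \<le> B" using g[OF \<eta>] by linarith
  then show ?thesis using hammersley_gen_bound[of g B, OF g \<eta>] by (simp add: algebra_simps)
qed

lemma tasep_gen_growth:
  assumes g: "\<And>\<zeta>. \<zeta> \<in> configs \<Longrightarrow> \<bar>g \<zeta>\<bar> \<le> B" and \<eta>: "\<eta> \<in> configs"
  shows "\<bar>tasep_gen g \<eta>\<bar> \<le> 2 * B * (1 + real (area \<eta>))"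
  using tasep_gen_bound[of g B 0 \<eta>] g \<eta> by simp

lemma integrable_gens:
  assumes g: "\<And>\<zeta>. \<zeta> \<in> configs \<Longrightarrow> \<bar>g \<zeta>\<bar> \<le> B" and s: "0 \<le> s"
  shows "integrable (P s step) (hammersley_gen g)" "integrable (P s step) (tasep_gen g)"
    "\<bar>mean s (hammersley_gen g)\<bar> \<le> 2 * B * exp (7 * s)" "\<bar>mean s (tasep_gen g)\<bar> \<le> 2 * B * exp (7 * s)"
proof -
  have L: "\<bar>hammersley_gen g \<eta>\<bar> \<le> 2 * B * (1 + real (area \<eta>)) ^ 1" if "\<eta> \<in> configs" for \<eta>
    using hammersley_gen_growth[of g B \<eta>, OF g that] by simp
  have T: "\<bar>tasep_gen g \<eta>\<bar> \<le> 2 * B * (1 + real (area \<eta>)) ^ 1" if "\<eta> \<in> configs" for \<eta>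
    using tasep_gen_growth[of g B \<eta>, OF g that] by simp
  show "integrable (P s step) (hammersley_gen g)" "\<bar>mean s (hammersley_gen g)\<bar> \<le> 2 * B * exp (7 * s)"
    by (rule integrable_growth[OF s _ L] mean_growth[OF s _ L]; simp)+
  show "integrable (P s step) (tasep_gen g)" "\<bar>mean s (tasep_gen g)\<bar> \<le> 2 * B * exp (7 * s)"
    by (rule integrable_growth[OF s _ T] mean_growth[OF s _ T]; simp)+
qed

lemma defect_0:
  assumes g: "\<And>\<zeta>. \<zeta> \<in> configs \<Longrightarrow> \<bar>g \<zeta>\<bar> \<le> B"
  shows "defect 0 g = 0"
  using hammersley_gen_bound[of g B, OF g step_in_configs] by (simp add: defect_def mean_0 area_step)

text \<open>The factor \<open>s\<close> contributes an extra \<open>mean s (tasep_gen g)\<close>,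
  which the commutation relation absorbs when the two generators are exchanged. Both generators send
  a bounded \<open>g\<close> to a function of linear growth, as \<open>forward_derivative\<close>
  requires.\<close>

lemma defect_derivative:
  assumes g: "\<And>\<zeta>. \<zeta> \<in> configs \<Longrightarrow> \<bar>g \<zeta>\<bar> \<le> B" and s: "0 \<le> s" "s \<le> t"
  shows "((\<lambda>s. defect s g) has_real_derivative defect s (tasep_gen g)) (at s within {0..t})"
proof -
  have LT: "mean s (tasep_gen (hammersley_gen g)) + mean s (tasep_gen g) = mean s (hammersley_gen (tasep_gen g))"
  proof -
    have "\<bar>tasep_gen (hammersley_gen g) \<eta>\<bar> \<le> 4 * (2 * B) * (1 + real (area \<eta>)) ^ 2" if "\<eta> \<in> configs" for \<eta>
      using tasep_gen_bound[of "hammersley_gen g" "2 * B" 1 \<eta>] hammersley_gen_growth[of g B, OF g] that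
      by (simp add: eval_nat_numeral)
    then have "integrable (P s step) (tasep_gen (hammersley_gen g))"
      using s by (intro integrable_growth[of _ 2]) auto
    then have "mean s (tasep_gen (hammersley_gen g)) + mean s (tasep_gen g)
        = mean s (\<lambda>\<eta>. tasep_gen (hammersley_gen g) \<eta> + tasep_gen g \<eta>)"
      using integrable_gens(2)[of g B, OF g s(1)] by simp
    also have "\<dots> = mean s (hammersley_gen (tasep_gen g))"
      using s(1) by (rule mean_cong) (simp add: generators_commute)
    finally show ?thesis .
  qed
  have "((\<lambda>s. defect s g) has_real_derivative mean s (tasep_gen (hammersley_gen g))
      + (1 * mean s (tasep_gen g) + s * mean s (tasep_gen (tasep_gen g)))) (at s within {0..t})"
    unfolding defect_def
    by (rule DERIV_add[OF forward_derivative[of "hammersley_gen g" "2 * B", OF hammersley_gen_growth[of g B, OF g] s]])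
      (auto intro!: derivative_eq_intros
        forward_derivative[of "tasep_gen g" "2 * B", OF tasep_gen_growth[of g B, OF g] s])
  moreover have "mean s (tasep_gen (hammersley_gen g))
      + (1 * mean s (tasep_gen g) + s * mean s (tasep_gen (tasep_gen g))) = defect s (tasep_gen g)"
    unfolding defect_def LT[symmetric] by simp
  ultimately show ?thesis by simp
qed

text \<open>Picard iteration of \<open>defect_derivative\<close> from the initial value 0. Each step
  replaces \<open>g\<close> by \<open>tasep_gen g\<close>, which keeps the support condition and
  multiplies the bound \<open>B\<close> by at most \<open>2 * (1 + n)\<close>. The case
  \<open>m = 0\<close> is the moment bound and supplies the prefactor.\<close>

lemma defect_iterated_bound:
  assumes "0 \<le> B" and g: "\<And>\<zeta>. \<zeta> \<in> configs \<Longrightarrow> \<bar>g \<zeta>\<bar> \<le> B"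
    and supp: "\<And>\<zeta>. \<zeta> \<in> configs \<Longrightarrow> area \<zeta> > n \<Longrightarrow> g \<zeta> = 0"
    and s: "0 \<le> s" "s \<le> T"
  shows "\<bar>defect s g\<bar> \<le> 2 * (1 + T) * exp (7 * T) * B * (2 * (1 + real n) * s) ^ m / fact m"
  using assms
proof (induction m arbitrary: g B s)
  case 0
  have e: "exp (7 * s) \<le> exp (7 * T)" using 0 by simp
  have "\<bar>defect s g\<bar> \<le> \<bar>mean s (hammersley_gen g)\<bar> + s * \<bar>mean s (tasep_gen g)\<bar>"
    unfolding defect_def using 0 by (intro order.trans[OF abs_triangle_ineq]) (simp add: abs_mult)
  also have "\<dots> \<le> 2 * B * exp (7 * s) + s * (2 * B * exp (7 * s))"
    using integrable_gens(3,4)[of g B, OF 0(2) 0(4)] 0 by (intro add_mono mult_left_mono) auto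
  also have "\<dots> \<le> 2 * B * exp (7 * T) + T * (2 * B * exp (7 * T))"
    using e 0 by (intro add_mono mult_mono) auto
  finally show ?case by (simp add: algebra_simps)
next
  case (Suc m)
  define c where "c = 2 * (1 + real n)"
  define K where "K = 2 * (1 + T) * exp (7 * T)"
  have c: "c > 0" by (simp add: c_def)
  have Tg: "\<bar>tasep_gen g \<zeta>\<bar> \<le> c * B" "area \<zeta> > n \<Longrightarrow> tasep_gen g \<zeta> = 0" if \<zeta>: "\<zeta> \<in> configs" for \<zeta>
  proof -
    obtain N where N: "agrees_outside N \<zeta>" using \<zeta> by (rule configs_agrees_outside)
    \<comment> \<open>Jumps only raise the area, so every configuration reached from
      \<open>\<zeta>\<close> again has area above \<open>n\<close>.\<close>
    show z: "tasep_gen g \<zeta> = 0" if "area \<zeta> > n"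
      unfolding tasep_gen_jumps[OF finite_jumps[OF N]]
      using that Suc.prems(3) area_move[OF N] configs_move[OF \<zeta>] \<zeta>
      by (intro sum.neutral) auto
    show "\<bar>tasep_gen g \<zeta>\<bar> \<le> c * B"
    proof (cases "area \<zeta> > n")
      case True
      then show ?thesis using z c Suc.prems(1) by simp
    next
      case False
      then have "2 * B * (1 + real (area \<zeta>)) \<le> 2 * B * (1 + real n)"
        using Suc.prems(1) by (intro mult_left_mono) auto
      then show ?thesis using tasep_gen_growth[of g B, OF Suc.prems(2) \<zeta>] by (simp add: c_def algebra_simps)
    qed
  qed
  have IH: "\<bar>defect u (tasep_gen g)\<bar> \<le> K * B * c * (c * u) ^ m / fact m" if "0 \<le> u" "u \<le> s" for u
  proof -
    have "\<bar>defect u (tasep_gen g)\<bar> \<le> K * (c * B) * (c * u) ^ m / fact m"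
      unfolding K_def c_def
      using that Suc.prems c Tg by (intro Suc.IH) (auto simp: c_def)
    then show ?thesis by (simp add: mult_ac)
  qed
  \<comment> \<open>\<open>H\<close> is the antiderivative, zero at time 0, of the induction bound
    for \<open>tasep_gen g\<close>. Monotonicity of \<open>H - defect\<close> and of
    \<open>H + defect\<close> bounds the defect from both sides.\<close>
  define H where "H u = K * B * (c * u) ^ Suc m / fact (Suc m)" for u
  have H': "(H has_real_derivative K * B * c * (c * u) ^ m / fact m) (at u within {0..s})" for u
  proof -
    have "(H has_real_derivative K * B * (real (Suc m) * (c * u) ^ m * c) / fact (Suc m)) (at u within {0..s})"
      unfolding H_def by (auto intro!: derivative_eq_intros simp del: power_Suc fact_Suc)
    moreover have "K * B * (real (Suc m) * (c * u) ^ m * c) / fact (Suc m) = K * B * c * (c * u) ^ m / fact m"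
      by (simp add: fact_Suc del: of_nat_Suc)
    ultimately show ?thesis by (simp only:)
  qed
  have D: "((\<lambda>s. defect s g) has_real_derivative defect u (tasep_gen g)) (at u within {0..s})"
    if "0 \<le> u" "u \<le> s" for u
    using Suc.prems(2) that by (rule defect_derivative[of g B])
  have z: "defect 0 g = 0" "H 0 = 0" using defect_0[of g B, OF Suc.prems(2)] by (simp_all add: H_def)
  have "H 0 - defect 0 g \<le> H s - defect s g"
    using IH by (intro nondecreasing_of_derivative_within[OF Suc.prems(4) DERIV_diff[OF H' D]]) (auto simp: abs_le_iff)
  moreover have "H 0 + defect 0 g \<le> H s + defect s g"
    using IH by (intro nondecreasing_of_derivative_within[OF Suc.prems(4) DERIV_add[OF H' D]]) (fastforce simp: abs_le_iff)+
  ultimately have "\<bar>defect s g\<bar> \<le> H s" using z by linarith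
  then show ?case by (simp add: H_def K_def c_def)
qed

text \<open>Take \<open>T = s\<close> in the iterated bound and let \<open>m\<close> tend to
  infinity: the bound is a multiple of a term of the exponential series.\<close>

lemma defect_finite_area:
  assumes "0 \<le> B" and g: "\<And>\<zeta>. \<zeta> \<in> configs \<Longrightarrow> \<bar>g \<zeta>\<bar> \<le> B"
    and supp: "\<And>\<zeta>. \<zeta> \<in> configs \<Longrightarrow> area \<zeta> > n \<Longrightarrow> g \<zeta> = 0" and s: "0 \<le> s"
  shows "defect s g = 0"
proof -
  define x where "x = 2 * (1 + real n) * s"
  have "(\<lambda>m. inverse (fact m) * x ^ m) \<longlonglongrightarrow> 0"
    by (rule summable_LIMSEQ_zero[OF summable_exp])
  then have "(\<lambda>m. 2 * (1 + s) * exp (7 * s) * B * (inverse (fact m) * x ^ m))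
      \<longlonglongrightarrow> 2 * (1 + s) * exp (7 * s) * B * 0"
    by (rule tendsto_mult[OF tendsto_const])
  then have lim: "(\<lambda>m. 2 * (1 + s) * exp (7 * s) * B * (inverse (fact m) * x ^ m)) \<longlonglongrightarrow> 0" by simp
  have "\<bar>defect s g\<bar> \<le> 2 * (1 + s) * exp (7 * s) * B * (inverse (fact m) * x ^ m)" for m
    using defect_iterated_bound[where g = g and n = n and m = m, OF assms order.refl] by (simp add: x_def field_simps)
  then have "\<bar>defect s g\<bar> \<le> 0" by (intro LIMSEQ_le_const[OF lim]) auto
  then show ?thesis by simp
qed

text \<open>Cut \<open>g\<close> off at area \<open>n\<close> and let \<open>n\<close> grow. At each
  configuration in \<open>configs\<close> the generators are finite sums, so they converge
  pointwise, and the third moment dominates them uniformly in \<open>n\<close>.\<close>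

lemma defect_bounded:
  assumes g: "\<And>\<zeta>. \<bar>g \<zeta>\<bar> \<le> B" and s: "0 \<le> s"
  shows "defect s g = 0"
proof -
  have B: "0 \<le> B" using g[of step] by linarith
  define h where "h n \<zeta> = (if area \<zeta> \<le> n then g \<zeta> else 0)" for n \<zeta>
  have hB: "\<bar>h n \<zeta>\<bar> \<le> B" for n \<zeta> using g B by (simp add: h_def)
  have lim: "(\<lambda>n. h n \<zeta>) \<longlonglongrightarrow> g \<zeta>" for \<zeta>
    by (rule tendsto_eventually) (auto simp: h_def eventually_sequentially intro!: exI[of _ "area \<zeta>"])
  have pow: "2 * B * (1 + real (area \<eta>)) \<le> 2 * B * (1 + real (area \<eta>)) ^ 3" for \<eta>
    using area_power_mono[of "2 * B" 1 \<eta>] B by simp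
  have "(\<lambda>n. mean s (hammersley_gen (h n))) \<longlonglongrightarrow> mean s (hammersley_gen g)"
  proof (rule mean_tendsto[OF s, of _ "2 * B"])
    show "\<bar>hammersley_gen (h n) \<eta>\<bar> \<le> 2 * B * (1 + real (area \<eta>)) ^ 3" if "\<eta> \<in> configs" for n \<eta>
      using hammersley_gen_growth[of "h n" B \<eta>, OF hB that] pow[of \<eta>] by linarith
  qed (rule hammersley_gen_tendsto[OF _ lim])
  moreover have "(\<lambda>n. mean s (tasep_gen (h n))) \<longlonglongrightarrow> mean s (tasep_gen g)"
  proof (rule mean_tendsto[OF s, of _ "2 * B"])
    show "\<bar>tasep_gen (h n) \<eta>\<bar> \<le> 2 * B * (1 + real (area \<eta>)) ^ 3" if "\<eta> \<in> configs" for n \<eta>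
      using tasep_gen_growth[of "h n" B \<eta>, OF hB that] pow[of \<eta>] by linarith
  qed (rule tasep_gen_tendsto[OF _ lim])
  ultimately have "(\<lambda>n. defect s (h n)) \<longlonglongrightarrow> defect s g"
    unfolding defect_def by (intro tendsto_intros)
  moreover have "defect s (h n) = 0" for n
    using B hB by (rule defect_finite_area[of _ _ n]) (auto simp: h_def s)
  ultimately show ?thesis by (simp add: LIMSEQ_const_iff)
qed

end

section \<open>The law of the process at a fixed time, and the conclusion\<close>

lemma markov_process_law:
  assumes P: "tasep_semigroup P" and X: "markov_process M configs P X"
    and init: "AE \<omega> in M. X 0 \<omega> = step" and t: "0 \<le> t"
  shows "X t \<in> M \<rightarrow>\<^sub>M count_space UNIV" "distr M (count_space UNIV) (X t) = measure_pmf (P t step)"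
proof -
  interpret tasep P by unfold_locales (rule P)
  interpret prob_space M using X by (simp add: markov_process_def)
  have mea: "X s \<in> M \<rightarrow>\<^sub>M count_space UNIV" if "0 \<le> s" for s
  proof -
    have "X s \<in> M \<rightarrow>\<^sub>M count_space configs" using X that by (simp add: markov_process_def)
    moreover have "(\<lambda>x. x) \<in> count_space configs \<rightarrow>\<^sub>M (count_space UNIV :: config measure)" by simp
    ultimately show ?thesis using measurable_compose by blast
  qed
  note [measurable] = mea[OF t] mea[of 0, simplified]
  show "X t \<in> M \<rightarrow>\<^sub>M count_space UNIV" by (rule mea[OF t])
  have joint: "prob {\<omega> \<in> space M. X t \<omega> = y} = pmf (P t step) y" for y
  proof -
    have "\<forall>J s h z y. finite J \<and> J \<subseteq> {0..s} \<and> s \<in> J \<and> 0 \<le> h \<longrightarrow>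
        prob {\<omega> \<in> space M. (\<forall>u\<in>J. X u \<omega> = z u) \<and> X (s + h) \<omega> = y} =
        prob {\<omega> \<in> space M. \<forall>u\<in>J. X u \<omega> = z u} * pmf (P h (z s)) y"
      using X by (simp add: markov_process_def)
    \<comment> \<open>The past is observed only at time 0, in the state \<open>step\<close>, which
      has probability 1.\<close>
    from this[rule_format, of "{0}" 0 t "\<lambda>_. step" y]
    have "prob {\<omega> \<in> space M. X 0 \<omega> = step \<and> X t \<omega> = y}
        = prob {\<omega> \<in> space M. X 0 \<omega> = step} * pmf (P t step) y"
      using t by simp
    moreover have "prob {\<omega> \<in> space M. X 0 \<omega> = step} = 1"
      using init by (intro prob_Collect_eq_1[THEN iffD2]) auto
    moreover have "prob {\<omega> \<in> space M. X 0 \<omega> = step \<and> X t \<omega> = y} = prob {\<omega> \<in> space M. X t \<omega> = y}"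
      using init by (intro finite_measure_eq_AE) auto
    ultimately show ?thesis by simp
  qed
  let ?D = "distr M (count_space UNIV) (X t)"
  interpret D: prob_space ?D by (rule prob_space_distr) measurable
  have single: "emeasure ?D {y} = emeasure (measure_pmf (P t step)) {y}" for y
  proof -
    have "emeasure ?D {y} = ennreal (prob {\<omega> \<in> space M. X t \<omega> = y})"
      by (simp add: emeasure_distr emeasure_eq_measure vimage_def Int_def conj_commute)
    then show ?thesis by (simp add: joint emeasure_pmf_single)
  qed
  \<comment> \<open>The type \<open>config\<close> is uncountable, so agreement on singletons alone
    does not identify the law. The countable support \<open>?S\<close> has mass 1 under both
    measures, and there singletons are enough.\<close>
  let ?S = "set_pmf (P t step)"
  have "emeasure ?D ?S = emeasure (measure_pmf (P t step)) ?S"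
    by (subst (1 2) emeasure_countable_singleton) (auto simp: single)
  also have "\<dots> = 1" using measure_pmf.emeasure_eq_1_AE[of ?S] by (simp add: AE_measure_pmf)
  finally have "AE x in ?D. x \<in> ?S"
    by (intro D.AE_prob_1) (simp add: D.emeasure_eq_measure)
  then show "?D = measure_pmf (P t step)"
    by (intro measure_eqI_countable_AE[of _ _ ?S]) (auto simp: single AE_measure_pmf)
qed

theorem proposition7p1:
  fixes M :: "'w measure" and \<eta> :: "real \<Rightarrow> 'w \<Rightarrow> config" and t :: real
    and f :: "config \<Rightarrow> real"
  assumes "tasep_from_step M \<eta>" and "t > 0" and "cylinder f"
  shows "integrable M (\<lambda>\<omega>. full_gen t f (\<eta> t \<omega>)) \<and>
         (\<integral>\<omega>. full_gen t f (\<eta> t \<omega>) \<partial>M) = 0"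
proof -
  obtain P where P: "tasep_semigroup P" and X: "markov_process M configs P \<eta>"
    and init: "AE \<omega> in M. \<eta> 0 \<omega> = step"
    using assms(1) by (auto simp: tasep_from_step_def)
  interpret tasep P by unfold_locales (rule P)
  have t: "0 \<le> t" using assms(2) by simp
  note law = markov_process_law[OF P X init t]
  obtain B where B: "\<And>\<zeta>. \<bar>f \<zeta>\<bar> \<le> B" using assms(3) by (rule cylinder_bounded) blast
  have full: "full_gen t f = (\<lambda>\<zeta>. t * tasep_gen f \<zeta> + hammersley_gen f \<zeta>)"
    by (simp add: full_gen_def fun_eq_iff)
  note int = integrable_gens(1,2)[of f B, OF B t]
  \<comment> \<open>Integrability and the integral are computed under \<open>P t step\<close> and
    carried to \<open>M\<close> through the law of \<open>\<eta> t\<close>; the mean of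
    \<open>full_gen t f\<close> is then \<open>defect t f\<close>.\<close>
  have "integrable (P t step) (full_gen t f)" unfolding full using int by simp
  then have "integrable M (\<lambda>\<omega>. full_gen t f (\<eta> t \<omega>))"
    using integrable_distr_eq[OF law(1), of "full_gen t f"] law(2) by simp
  moreover have "(\<integral>\<omega>. full_gen t f (\<eta> t \<omega>) \<partial>M) = mean t (full_gen t f)"
    using integral_distr[OF law(1), of "full_gen t f"] law(2) by simp
  moreover have "mean t (full_gen t f) = defect t f"
    unfolding full defect_def using int by simp
  ultimately show ?thesis using defect_bounded[OF B t] by simp
qed

end
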